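(* Let $\Sigma\subset\mathbb{R}^{n+1}$ be a $C^3$-smooth, strictly convex hypersurface with unit normal field $\nu$ whose radii of curvature $(r_i)_{i=1}^n$ have multiplicity $1$. Let $S_j:=\mathcal{Y}_j(\Sigma)$ be the focal sheets, with $\mathcal{Y}_j$ a diffeomorphism (onto its image $S_j$) for all $j\in\{1,\ldots,n\}$. If $X_j\in\Gamma(T\Sigma)$ satisfy $$r_j\overline{\nabla}_{X_j}\nu=X_j\quad\text{and}\quad \mathrm{d}r_j(X_j)=1,\qquad j\in\{1,\dots,n\},$$ then for each $i\in\{1,\ldots,n\}$ the Ricci curvature of $S_i$ satisfies $$(\mathcal{Y}_i^\ast\mathrm{Ric})(X_i,X_i)=\sum_{\substack{j=1\\ j\neq i}}^n\frac{X_i(s_{ij})-1}{(s_{ij})^2}.$$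
   Context: $\overline\nabla$ is the flat connection on $\mathbb{R}^{n+1}$. The shape operator of $\Sigma$ is $X\mapsto\overline\nabla_X\nu$; the radii of curvature $r_i:\Sigma\to\mathbb{R}$ are the reciprocals of its eigenvalues (the principal curvatures, which are non-zero by strict convexity), so $r_i(q)\overline\nabla_X\nu=X$ for principal directions $X\in T_q\Sigma$ belonging to $r_i$. Multiplicity $1$ means $r_i(q)\neq r_j(q)$ for all $q\in\Sigma$ and $i\ne j$. For each $i$ the map $\mathcal{Y}_i:\Sigma\to\mathbb{R}^{n+1}$ is $\mathcal{Y}_i(q)=q-r_i(q)\nu(q)$, and its image is the focal sheet of $\Sigma$ associated to $r_i$. The astigmatisms are $s_{ij}:\Sigma\to\mathbb{R}$, $s_{ij}(q)=r_i(q)-r_j(q)$, and $X_i(s_{ij})=\mathrm{d}s_{ij}(X_i)$. The hypersurface $S_i$ carries the metric induced from $\mathbb{R}^{n+1}$; focal sheets are considered in the situation where they are $C^2$-smooth hypersurfaces. $\mathrm{Ric}$ is the Ricci tensor of $S_i$ and $(\mathcal{Y}_i^\ast\mathrm{Ric})(X_i,X_i)=\mathrm{Ric}(\mathrm{d}\mathcal{Y}_i(X_i),\mathrm{d}\mathcal{Y}_i(X_i))$. *)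

theory Defs
  imports "HOL-Analysis.Analysis"
begin

text \<open>
  The ambient space \<open>R\<^sup>n\<^sup>+\<^sup>1\<close> is the type \<open>(real ^ 'n) \<times> real\<close> with \<open>n = CARD('n)\<close>; its library norm and
  inner product are the Euclidean ones. Local coordinates live in \<open>real ^ 'n\<close>, and the index set
  \<open>{1,...,n}\<close> is the type \<open>'n\<close>.
\<close>

type_synonym 'n ambient = "(real ^ 'n) \<times> real"


section \<open>Hypersurfaces\<close>

text \<open>To be used for open \<open>U\<close>; all directional derivatives up to order \<open>k\<close> exist and are continuous.\<close>

fun Ck_on :: "nat \<Rightarrow> 'a::real_normed_vector set \<Rightarrow> ('a \<Rightarrow> 'b::real_normed_vector) \<Rightarrow> bool" where
  "Ck_on 0 U f \<longleftrightarrow> continuous_on U f"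
| "Ck_on (Suc k) U f \<longleftrightarrow>
     (\<forall>x\<in>U. f differentiable (at x)) \<and> (\<forall>v. Ck_on k U (\<lambda>x. frechet_derivative f (at x) v))"

definition local_param ::
    "nat \<Rightarrow> 'b::real_normed_vector set \<Rightarrow> 'a::real_normed_vector set \<Rightarrow> ('a \<Rightarrow> 'b) \<Rightarrow> bool" where
  "local_param k S U \<phi> \<longleftrightarrow>
     open U \<and> Ck_on k U \<phi> \<and> (\<forall>u\<in>U. inj (frechet_derivative \<phi> (at u))) \<and>
     openin (top_of_set S) (\<phi> ` U) \<and> (\<exists>\<psi>. homeomorphism U (\<phi> ` U) \<phi> \<psi>)"

definition hypersurface :: "nat \<Rightarrow> ('n::finite) ambient set \<Rightarrow> bool" where
  "hypersurface k S \<longleftrightarrow>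
     (\<forall>p\<in>S. \<exists>(U :: (real ^ 'n) set) \<phi>. local_param k S U \<phi> \<and> p \<in> \<phi> ` U)"

definition tangent_space :: "'a::real_normed_vector set \<Rightarrow> 'a \<Rightarrow> 'a set" where
  "tangent_space S p =
     {v. \<exists>\<gamma>::real \<Rightarrow> 'a. \<gamma> 0 = p \<and> (\<forall>\<^sub>F t in at 0. \<gamma> t \<in> S) \<and> (\<gamma> has_vector_derivative v) (at 0)}"

text \<open>
  The differential of \<open>f\<close> (a function or a vector-valued map on \<open>S\<close>) in the direction \<open>X\<close>, which is
  also the flat derivative of \<open>f\<close> along \<open>X\<close>. A derivative within \<open>S\<close> depends only on the values of \<open>f\<close>
  on \<open>S\<close>. As a linear map on the ambient space it is not unique, but its values on tangent vectors of
  \<open>S\<close> are (they are the derivatives of \<open>f\<close> along curves in \<open>S\<close>), so it is only to be used there.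
\<close>

definition dif :: "'a::real_normed_vector set \<Rightarrow> ('a \<Rightarrow> 'b::real_normed_vector) \<Rightarrow> 'a \<Rightarrow> 'a \<Rightarrow> 'b" where
  "dif S f p X = frechet_derivative f (at p within S) X"

definition Ck_map :: "nat \<Rightarrow> ('n::finite) ambient set \<Rightarrow> ('n ambient \<Rightarrow> 'b::real_normed_vector) \<Rightarrow> bool"
  where
  "Ck_map k S f \<longleftrightarrow>
     (\<forall>(U :: (real ^ 'n) set) \<phi>. local_param k S U \<phi> \<longrightarrow> Ck_on k U (f \<circ> \<phi>))"

text \<open>\<open>C\<^sup>1\<close> diffeomorphisms: on a \<open>C\<^sup>3\<close> hypersurface the radii of curvature are in general only \<open>C\<^sup>1\<close>.\<close>

definition diffeomorphism ::
    "('n::finite) ambient set \<Rightarrow> 'n ambient set \<Rightarrow> ('n ambient \<Rightarrow> 'n ambient) \<Rightarrow> bool" where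
  "diffeomorphism S T f \<longleftrightarrow> bij_betw f S T \<and> Ck_map 1 S f \<and> Ck_map 1 T (inv_into S f)"

definition tangent_field :: "'a::real_normed_vector set \<Rightarrow> ('a \<Rightarrow> 'a) \<Rightarrow> bool" where
  "tangent_field S X \<longleftrightarrow> continuous_on S X \<and> (\<forall>p\<in>S. X p \<in> tangent_space S p)"

definition unit_normal_field :: "'a::real_inner set \<Rightarrow> ('a \<Rightarrow> 'a) \<Rightarrow> bool" where
  "unit_normal_field S \<nu> \<longleftrightarrow>
     continuous_on S \<nu> \<and> (\<forall>p\<in>S. norm (\<nu> p) = 1 \<and> (\<forall>v\<in>tangent_space S p. \<nu> p \<bullet> v = 0))"


section \<open>Radii of curvature and focal sheets\<close>

text \<open>
  \<open>dif S \<nu> p\<close> is the shape operator at \<open>p\<close>. Strict convexity is definiteness of the second fundamental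
  form; the sign depends on the choice of \<open>\<nu>\<close>.
\<close>

definition strictly_convex :: "'a::real_inner set \<Rightarrow> ('a \<Rightarrow> 'a) \<Rightarrow> bool" where
  "strictly_convex S \<nu> \<longleftrightarrow>
     (\<forall>p\<in>S. (\<forall>X\<in>tangent_space S p - {0}. dif S \<nu> p X \<bullet> X > 0) \<or>
            (\<forall>X\<in>tangent_space S p - {0}. dif S \<nu> p X \<bullet> X < 0))"

definition principal_curvatures :: "'a::real_normed_vector set \<Rightarrow> ('a \<Rightarrow> 'a) \<Rightarrow> 'a \<Rightarrow> real set" where
  "principal_curvatures S \<nu> p =
     {\<kappa>. \<exists>X\<in>tangent_space S p. X \<noteq> 0 \<and> dif S \<nu> p X = \<kappa> *\<^sub>R X}"

text \<open>
  The family \<open>r\<close> lists the radii of curvature, all of multiplicity 1: by the first clause these are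
  exactly the reciprocals of the principal curvatures, by the second there are \<open>CARD('n)\<close> distinct
  ones at each point.
\<close>

definition simple_radii_of_curvature ::
    "('n::finite) ambient set \<Rightarrow> ('n ambient \<Rightarrow> 'n ambient) \<Rightarrow> ('n \<Rightarrow> 'n ambient \<Rightarrow> real) \<Rightarrow> bool" where
  "simple_radii_of_curvature S \<nu> r \<longleftrightarrow>
     (\<forall>p\<in>S. range (\<lambda>i. r i p) = (\<lambda>\<kappa>. 1 / \<kappa>) ` principal_curvatures S \<nu> p) \<and>
     (\<forall>p\<in>S. \<forall>i j. i \<noteq> j \<longrightarrow> r i p \<noteq> r j p)"

definition focal_map :: "('a::real_vector \<Rightarrow> 'a) \<Rightarrow> ('i \<Rightarrow> 'a \<Rightarrow> real) \<Rightarrow> 'i \<Rightarrow> 'a \<Rightarrow> 'a" where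
  "focal_map \<nu> r i p = p - r i p *\<^sub>R \<nu> p"

definition focal_sheet ::
    "'a::real_vector set \<Rightarrow> ('a \<Rightarrow> 'a) \<Rightarrow> ('i \<Rightarrow> 'a \<Rightarrow> real) \<Rightarrow> 'i \<Rightarrow> 'a set" where
  "focal_sheet S \<nu> r i = focal_map \<nu> r i ` S"

definition astigmatism :: "('i \<Rightarrow> 'a \<Rightarrow> real) \<Rightarrow> 'i \<Rightarrow> 'i \<Rightarrow> 'a \<Rightarrow> real" where
  "astigmatism r i j p = r i p - r j p"


section \<open>The Ricci tensor of the induced metric\<close>

definition pd :: "'n::finite \<Rightarrow> (real ^ 'n \<Rightarrow> 'b::real_normed_vector) \<Rightarrow> real ^ 'n \<Rightarrow> 'b" where
  "pd k f u = frechet_derivative f (at u) (axis k 1)"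

definition induced_metric :: "(real ^ 'n \<Rightarrow> 'b::real_inner) \<Rightarrow> real ^ 'n::finite \<Rightarrow> real ^ 'n ^ 'n" where
  "induced_metric \<phi> u = (\<chi> j k. pd j \<phi> u \<bullet> pd k \<phi> u)"

text \<open>\<open>christoffel g m k j\<close> is the symbol with upper index \<open>m\<close> and lower indices \<open>k\<close>, \<open>j\<close>.\<close>

definition christoffel ::
    "(real ^ 'n \<Rightarrow> real ^ 'n ^ 'n) \<Rightarrow> 'n::finite \<Rightarrow> 'n \<Rightarrow> 'n \<Rightarrow> real ^ 'n \<Rightarrow> real" where
  "christoffel g m k j u =
     (\<Sum>l\<in>UNIV. matrix_inv (g u) $ m $ l *
        (pd k (\<lambda>x. g x $ j $ l) u + pd j (\<lambda>x. g x $ k $ l) u - pd l (\<lambda>x. g x $ k $ j) u)) / 2"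

text \<open>
  The metric of a \<open>C\<^sup>2\<close> hypersurface is only \<open>C\<^sup>1\<close> in \<open>C\<^sup>2\<close> coordinates, so its Christoffel symbols are
  continuous but need not be differentiable. The curvature involves only their antisymmetrised
  derivatives \<open>\<partial>\<^sub>k \<omega>\<^sub>l - \<partial>\<^sub>l \<omega>\<^sub>k\<close>. For a continuous 1-form \<open>\<omega>\<close> this exterior derivative is taken as the
  circulation density: the limit of the line integral of \<open>\<omega>\<close> around the coordinate square with
  corner \<open>u\<close> and sides \<open>\<epsilon> e\<^sub>k\<close>, \<open>\<epsilon> e\<^sub>l\<close>, divided by its area \<open>\<epsilon>\<^sup>2\<close>. Lemma \<open>ext_deriv_differentiable\<close> shows
  that this is \<open>\<partial>\<^sub>k \<omega>\<^sub>l - \<partial>\<^sub>l \<omega>\<^sub>k\<close> wherever \<open>\<omega>\<close> is differentiable, so for metrics of class \<open>C\<^sup>2\<close> the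
  curvature below is the classical one.
\<close>

definition circulation :: "('n::finite \<Rightarrow> real ^ 'n \<Rightarrow> real) \<Rightarrow> 'n \<Rightarrow> 'n \<Rightarrow> real ^ 'n \<Rightarrow> real \<Rightarrow> real" where
  "circulation \<omega> k l u \<epsilon> =
     \<epsilon> * integral {0..1} (\<lambda>t.
        (\<omega> l (u + \<epsilon> *\<^sub>R axis k 1 + (\<epsilon> * t) *\<^sub>R axis l 1) - \<omega> l (u + (\<epsilon> * t) *\<^sub>R axis l 1)) -
        (\<omega> k (u + \<epsilon> *\<^sub>R axis l 1 + (\<epsilon> * t) *\<^sub>R axis k 1) - \<omega> k (u + (\<epsilon> * t) *\<^sub>R axis k 1)))"

definition ext_deriv :: "('n::finite \<Rightarrow> real ^ 'n \<Rightarrow> real) \<Rightarrow> 'n \<Rightarrow> 'n \<Rightarrow> real ^ 'n \<Rightarrow> real" where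
  "ext_deriv \<omega> k l u = Lim (at 0) (\<lambda>\<epsilon>. circulation \<omega> k l u \<epsilon> / \<epsilon>\<^sup>2)"

lemma ext_deriv_differentiable:
  fixes \<omega> :: "'n::finite \<Rightarrow> real ^ 'n \<Rightarrow> real"
  assumes "open U" "u \<in> U" and cont: "\<And>i. continuous_on U (\<omega> i)"
    and diff: "\<And>i. \<omega> i differentiable (at u)"
  shows "ext_deriv \<omega> k l u = pd k (\<omega> l) u - pd l (\<omega> k) u"
proof -
  define L where "L i = frechet_derivative (\<omega> i) (at u)" for i
  have L: "(\<omega> i has_derivative L i) (at u)" for i
    using diff unfolding L_def frechet_derivative_works by blast
  have lin: "linear (L i)" for i
    using L has_derivative_linear by blast
  define c where "c = pd k (\<omega> l) u - pd l (\<omega> k) u"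
  have c: "c = L l (axis k 1) - L k (axis l 1)"
    by (simp add: c_def pd_def L_def)
  have "((\<lambda>\<epsilon>. circulation \<omega> k l u \<epsilon> / \<epsilon>\<^sup>2) \<longlongrightarrow> c) (at 0)"
  proof (rule tendstoI)
    fix e :: real assume "e > 0"
    define \<eta> where "\<eta> = e / 12"
    have "\<eta> > 0" using \<open>e > 0\<close> by (simp add: \<eta>_def)
    have ev: "\<forall>i. \<exists>d>0. \<forall>y. norm (y - u) < d \<longrightarrow> norm (\<omega> i y - \<omega> i u - L i (y - u)) \<le> \<eta> * norm (y - u)"
      using L \<open>\<eta> > 0\<close> unfolding has_derivative_at_alt by blast
    obtain d1 where d1: "d1 > 0"
        "\<And>y. norm (y - u) < d1 \<Longrightarrow> norm (\<omega> k y - \<omega> k u - L k (y - u)) \<le> \<eta> * norm (y - u)"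
      using ev by blast
    obtain d2 where d2: "d2 > 0"
        "\<And>y. norm (y - u) < d2 \<Longrightarrow> norm (\<omega> l y - \<omega> l u - L l (y - u)) \<le> \<eta> * norm (y - u)"
      using ev by blast
    obtain d3 where d3: "d3 > 0" "ball u d3 \<subseteq> U"
      using assms(1,2) openE by blast
    define d where "d = min d1 (min d2 d3) / 2"
    have "d > 0" using d1 d2 d3 by (simp add: d_def)
    have main: "dist (circulation \<omega> k l u \<epsilon> / \<epsilon>\<^sup>2) c < e" if "\<epsilon> \<noteq> 0" "\<bar>\<epsilon>\<bar> < d" for \<epsilon>
    proof -
      have nb: "norm (a *\<^sub>R axis i (1::real) + (\<epsilon> * t) *\<^sub>R axis j 1) \<le> 2 * \<bar>\<epsilon>\<bar>"
        if "t \<in> {0..1}" "\<bar>a\<bar> \<le> \<bar>\<epsilon>\<bar>" for a t and i j :: 'n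
      proof -
        have "norm (a *\<^sub>R axis i (1::real) + (\<epsilon> * t) *\<^sub>R axis j 1) \<le> \<bar>a\<bar> + \<bar>\<epsilon>\<bar> * \<bar>t\<bar>"
          by (rule norm_triangle_le) (simp add: norm_axis_1 abs_mult)
        also have "\<dots> \<le> \<bar>\<epsilon>\<bar> + \<bar>\<epsilon>\<bar> * 1"
          using that by (intro add_mono mult_left_mono) auto
        finally show ?thesis by simp
      qed
      have inU: "u + a *\<^sub>R axis i 1 + (\<epsilon> * t) *\<^sub>R axis j 1 \<in> U"
        if "t \<in> {0..1}" "\<bar>a\<bar> \<le> \<bar>\<epsilon>\<bar>" for a t and i j :: 'n
        using nb[OF that, of i j] d3(2) \<open>\<bar>\<epsilon>\<bar> < d\<close>
        by (intro subsetD[OF d3(2)]) (auto simp: dist_norm d_def norm_minus_commute add.assoc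
            norm_minus_cancel[of "_ + _", symmetric] simp del: norm_minus_cancel)
      have cont': "continuous_on {0..1} (\<lambda>t. \<omega> m (u + a *\<^sub>R axis i 1 + (\<epsilon> * t) *\<^sub>R axis j 1))"
        if "\<bar>a\<bar> \<le> \<bar>\<epsilon>\<bar>" for a m and i j :: 'n
        by (rule continuous_on_compose2[OF cont]) (use inU that in \<open>auto intro!: continuous_intros\<close>)
      have est: "\<bar>\<omega> m (u + a *\<^sub>R axis i 1 + (\<epsilon> * t) *\<^sub>R axis j 1) - \<omega> m u
            - (a * L m (axis i 1) + \<epsilon> * t * L m (axis j 1))\<bar> \<le> 2 * \<eta> * \<bar>\<epsilon>\<bar>"
        if "t \<in> {0..1}" "\<bar>a\<bar> \<le> \<bar>\<epsilon>\<bar>" "m = k \<or> m = l" for a t m and i j :: 'n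
      proof -
        define h where "h = a *\<^sub>R axis i (1::real) + (\<epsilon> * t) *\<^sub>R axis j 1"
        have h: "norm h \<le> 2 * \<bar>\<epsilon>\<bar>" using nb that by (simp add: h_def)
        then have "norm h < d1" "norm h < d2" using \<open>\<bar>\<epsilon>\<bar> < d\<close> by (auto simp: d_def)
        then have "norm (\<omega> m (u + h) - \<omega> m u - L m h) \<le> \<eta> * norm h"
          using d1(2)[of "u + h"] d2(2)[of "u + h"] that(3) by auto
        also have "\<dots> \<le> \<eta> * (2 * \<bar>\<epsilon>\<bar>)" using h \<open>\<eta> > 0\<close> by (intro mult_left_mono) auto
        finally show ?thesis
          by (simp add: h_def linear_add[OF lin] linear_scale[OF lin] algebra_simps)
      qed
      define F where "F t =
        (\<omega> l (u + \<epsilon> *\<^sub>R axis k 1 + (\<epsilon> * t) *\<^sub>R axis l 1) - \<omega> l (u + (\<epsilon> * t) *\<^sub>R axis l 1)) -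
        (\<omega> k (u + \<epsilon> *\<^sub>R axis l 1 + (\<epsilon> * t) *\<^sub>R axis k 1) - \<omega> k (u + (\<epsilon> * t) *\<^sub>R axis k 1))" for t
      have "continuous_on {0..1} F"
        unfolding F_def
        using cont'[of \<epsilon> l k l] cont'[of 0 l k l] cont'[of \<epsilon> k l k] cont'[of 0 k l k]
        by (intro continuous_on_diff) simp_all
      then have int: "(F has_integral integral {0..1} F) {0..1}"
        by (simp add: integrable_continuous_real integrable_integral)
      have "((\<lambda>t. F t - \<epsilon> * c) has_integral (integral {0..1} F - \<epsilon> * c)) {0..1}"
        using has_integral_diff[OF int has_integral_const_real[of "\<epsilon> * c" 0 1]] by simp
      moreover have "norm (F t - \<epsilon> * c) \<le> 8 * \<eta> * \<bar>\<epsilon>\<bar>" if "t \<in> {0..1}" for t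
        using est[OF that, of \<epsilon> l k l] est[OF that, of 0 l k l]
          est[OF that, of \<epsilon> k l k] est[OF that, of 0 k l k]
        unfolding F_def c real_norm_def by (simp add: algebra_simps) linarith
      ultimately have "norm (integral {0..1} F - \<epsilon> * c) \<le> 8 * \<eta> * \<bar>\<epsilon>\<bar>"
        using has_integral_bound_real[of "8 * \<eta> * \<bar>\<epsilon>\<bar>" "{}" "\<lambda>t. F t - \<epsilon> * c" _ 0 1] \<open>\<eta> > 0\<close> by simp
      moreover have "circulation \<omega> k l u \<epsilon> = \<epsilon> * integral {0..1} F"
        unfolding circulation_def F_def ..
      then have "circulation \<omega> k l u \<epsilon> / \<epsilon>\<^sup>2 - c = (integral {0..1} F - \<epsilon> * c) / \<epsilon>"
        using \<open>\<epsilon> \<noteq> 0\<close> by (simp add: field_simps power2_eq_square)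
      ultimately have "dist (circulation \<omega> k l u \<epsilon> / \<epsilon>\<^sup>2) c \<le> 8 * \<eta>"
        using \<open>\<epsilon> \<noteq> 0\<close> by (simp add: dist_norm abs_divide pos_divide_le_eq)
      also have "\<dots> < e" using \<open>e > 0\<close> by (simp add: \<eta>_def)
      finally show ?thesis .
    qed
    show "\<forall>\<^sub>F \<epsilon> in at 0. dist (circulation \<omega> k l u \<epsilon> / \<epsilon>\<^sup>2) c < e"
      unfolding eventually_at using main \<open>d > 0\<close> by (auto intro!: exI[of _ d])
  qed
  then show ?thesis
    unfolding ext_deriv_def c_def by (intro tendsto_Lim) simp_all
qed

text \<open>
  \<open>riemann g m j k l\<close> is the \<open>m\<close>-th component of \<open>R(\<partial>\<^sub>k, \<partial>\<^sub>l) \<partial>\<^sub>j\<close>, so that round spheres have positive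
  Ricci curvature.
\<close>

definition riemann ::
    "(real ^ 'n \<Rightarrow> real ^ 'n ^ 'n) \<Rightarrow> 'n::finite \<Rightarrow> 'n \<Rightarrow> 'n \<Rightarrow> 'n \<Rightarrow> real ^ 'n \<Rightarrow> real" where
  "riemann g m j k l u =
     ext_deriv (\<lambda>i. christoffel g m i j) k l u +
     (\<Sum>p\<in>UNIV. christoffel g m k p u * christoffel g p l j u
              - christoffel g m l p u * christoffel g p k j u)"

definition ricci_coeff ::
    "(real ^ 'n \<Rightarrow> real ^ 'n ^ 'n) \<Rightarrow> 'n::finite \<Rightarrow> 'n \<Rightarrow> real ^ 'n \<Rightarrow> real" where
  "ricci_coeff g j l u = (\<Sum>m\<in>UNIV. riemann g m j m l u)"

text \<open>
  \<open>ricci S p V W\<close>, for tangent vectors \<open>V\<close>, \<open>W\<close> of \<open>S\<close> at \<open>p\<close>, is the number computed from the components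
  of the metric in every local parametrization of class \<open>C\<^sup>2\<close> around \<open>p\<close>.
\<close>

definition ricci :: "('n::finite) ambient set \<Rightarrow> 'n ambient \<Rightarrow> 'n ambient \<Rightarrow> 'n ambient \<Rightarrow> real" where
  "ricci S p V W =
     (THE c. \<forall>(U :: (real ^ 'n) set) \<phi> u a b.
        local_param 2 S U \<phi> \<and> u \<in> U \<and> \<phi> u = p \<and>
        frechet_derivative \<phi> (at u) a = V \<and> frechet_derivative \<phi> (at u) b = W \<longrightarrow>
        c = (\<Sum>j\<in>UNIV. \<Sum>l\<in>UNIV. ricci_coeff (induced_metric \<phi>) j l u * a $ j * b $ l))"

end

theory Submission
  imports Defs
begin

text \<open>
  The unit normal of \<open>S\<^sub>i\<close> at \<open>\<Y>\<^sub>i(q)\<close> is \<open>E\<^sub>i = X\<^sub>i / |X\<^sub>i|\<close>, and \<open>d\<Y>\<^sub>i(X\<^sub>i) = -\<nu>\<close>. Gauss' equation for \<open>S\<^sub>i\<close>,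
  with its second fundamental form expressed through \<open>dE\<^sub>i\<close>, gives \<open>Ric(\<nu>, \<nu>)\<close> as a sum over \<open>j \<noteq> i\<close> of multiples
  of \<open>\<langle>\<nabla>\<^sub>X\<^sub>j E\<^sub>i, E\<^sub>j\<rangle>\<close>, and Codazzi's equation for \<open>\<Sigma>\<close> turns these into \<open>X\<^sub>i(r\<^sub>j)\<close>.

  The sheets are only \<open>C\<^sup>2\<close> and the \<open>E\<^sub>j\<close> only differentiable, so both equations are read as equalities of circulation
  densities: for \<open>F\<close> of class \<open>C\<^sup>1\<close> and \<open>G\<close> continuous and differentiable at the point, the 1-form \<open>\<langle>dF, G\<rangle>\<close>
  has circulation density \<open>\<langle>dG \<and> dF\<rangle>\<close>, because subtracting the exact form \<open>\<langle>dF, G(u)\<rangle>\<close> leaves a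
  form that is differentiable at \<open>u\<close>. Gauss' equation is the case \<open>F = \<partial>\<^sub>j\<phi>\<close> with \<open>G\<close> a dual frame vector, as
  \<open>\<Gamma>\<^sup>m\<^sub>i\<^sub>j = \<langle>\<partial>\<^sub>i\<partial>\<^sub>j\<phi>, G\<^sup>m\<rangle>\<close>; Codazzi's is the identity \<open>\<langle>d\<sigma>, E\<^sub>j\<rangle> = \<langle>d\<nu>, r\<^sub>j E\<^sub>j\<rangle>\<close>.
\<close>

section \<open>Differentiation and circulation densities\<close>

text \<open>Splitting f y as f x + (f y - f x), the second product is o(|y - x|), because h y = O(|y
  - x|) and f y - f x tends to 0. It serves as product rule when one factor is merely continuous and
  the other vanishes at the point.\<close>

lemma (in bounded_bilinear) has_derivative_vanishing:
  assumes f: "continuous (at x within S) f"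
    and h: "(h has_derivative h') (at x within S)" and h0: "h x = 0"
  shows "((\<lambda>y. prod (f y) (h y)) has_derivative (\<lambda>v. prod (f x) (h' v))) (at x within S)"
proof -
  obtain K where K: "0 < K" "\<And>a b. norm (prod a b) \<le> norm a * norm b * K"
    using pos_bounded by blast
  obtain B where B: "\<And>v. norm (h' v) \<le> norm v * B"
    using bounded_linear.bounded[OF has_derivative_bounded_linear[OF h]] by blast
  \<comment> \<open>\<open>q\<close> is the normalised remainder of \<open>h\<close>, so that |h y|
    / |y - x| \<le> |q y| + |B|.\<close>
  define q where "q y = (1 / norm (y - x)) *\<^sub>R (h y - h' (y - x))" for y
  have q: "(q \<longlongrightarrow> 0) (at x within S)"
    using h h0 by (simp add: has_derivative_within q_def[abs_def])
  have "((\<lambda>y. norm (f y - f x) * (norm (q y) + \<bar>B\<bar>) * K) \<longlongrightarrow> norm (f x - f x) * (norm (0::'b) + \<bar>B\<bar>) * K)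
      (at x within S)"
    by (intro tendsto_intros q f[unfolded continuous_within])
  then have lim: "((\<lambda>y. norm (f y - f x) * (norm (q y) + \<bar>B\<bar>) * K) \<longlongrightarrow> 0) (at x within S)"
    by simp
  have bound: "norm ((1 / norm (y - x)) *\<^sub>R prod (f y - f x) (h y)) \<le> norm (f y - f x) * (norm (q y) + \<bar>B\<bar>) * K"
    for y
  proof -
    have "norm ((1 / norm (y - x)) *\<^sub>R h y) \<le> norm (q y) + norm ((1 / norm (y - x)) *\<^sub>R h' (y - x))"
      unfolding q_def by (rule order_trans[OF _ norm_triangle_ineq]) (simp flip: scaleR_add_right)
    also have "norm ((1 / norm (y - x)) *\<^sub>R h' (y - x)) \<le> \<bar>B\<bar>"
    proof (cases "y = x")
      case False
      have "norm (h' (y - x)) \<le> norm (y - x) * \<bar>B\<bar>"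
        by (rule order_trans[OF B]) (simp add: mult_left_mono)
      then show ?thesis using False by (simp add: divide_simps mult.commute)
    qed simp
    finally have "norm ((1 / norm (y - x)) *\<^sub>R h y) \<le> norm (q y) + \<bar>B\<bar>" by simp
    then have "norm (prod (f y - f x) ((1 / norm (y - x)) *\<^sub>R h y)) \<le> norm (f y - f x) * (norm (q y) + \<bar>B\<bar>) * K"
      by (intro order_trans[OF K(2)] mult_right_mono mult_left_mono) (use K(1) in auto)
    then show ?thesis by (simp add: scaleR_right)
  qed
  have "((\<lambda>y. (1 / norm (y - x)) *\<^sub>R prod (f y - f x) (h y)) \<longlongrightarrow> 0) (at x within S)"
    by (rule Lim_null_comparison[OF always_eventually lim]) (use bound in blast)
  then have 2: "((\<lambda>y. prod (f y - f x) (h y)) has_derivative (\<lambda>v. 0)) (at x within S)"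
    unfolding has_derivative_within by (simp add: zero_left)
  have 1: "((\<lambda>y. prod (f x) (h y)) has_derivative (\<lambda>v. prod (f x) (h' v))) (at x within S)"
    by (rule bounded_linear.has_derivative[OF bounded_linear_right h])
  show ?thesis
    using has_derivative_add[OF 1 2] by (simp add: diff_left)
qed

lemmas has_derivative_inner_vanishing = bounded_bilinear.has_derivative_vanishing[OF bounded_bilinear_inner]
lemmas has_derivative_scaleR_vanishing = bounded_bilinear.has_derivative_vanishing[OF bounded_bilinear_scaleR]

text \<open>Applying \<open>L\<close> to the expansion of \<open>\<phi>\<close> at
  \<open>g x\<close> gives g y - g x = L (F y - F x) - L (R y) with R y = o(|g y - g x|). Absorbing
  the last term first shows |g y - g x| = O(|y - x|), after which that term is o(|y - x|). Only a
  left inverse of \<open>\<phi>'\<close> enters, so parametrizations of hypersurfaces are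
  covered.\<close>

lemma has_derivative_left_inverse:
  assumes \<phi>: "(\<phi> has_derivative \<phi>') (at (g x))"
    and L: "bounded_linear L" "\<And>v. L (\<phi>' v) = v"
    and g: "continuous (at x within S) g"
    and F: "(F has_derivative F') (at x within S)"
    and eq: "\<forall>\<^sub>F y in at x within S. \<phi> (g y) = F y" "\<phi> (g x) = F x"
  shows "(g has_derivative (\<lambda>v. L (F' v))) (at x within S)"
  unfolding has_derivative_within_alt2
proof (intro conjI allI impI)
  have blF: "bounded_linear F'" by (rule has_derivative_bounded_linear[OF F])
  show "bounded_linear (\<lambda>v. L (F' v))"
    by (rule bounded_linear_compose[OF L(1) blF])
  obtain K where K: "0 < K" "\<And>v. norm (L v) \<le> norm v * K"
    using bounded_linear.pos_bounded[OF L(1)] by blast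
  obtain B where B: "0 < B" "\<And>v. norm (F' v) \<le> norm v * B"
    using bounded_linear.pos_bounded[OF blF] by blast
  define R where "R y = \<phi> (g y) - \<phi> (g x) - \<phi>' (g y - g x)" for y
  have evR: "\<forall>\<^sub>F y in at x within S. norm (R y) \<le> \<eta> * norm (g y - g x)" if "\<eta> > 0" for \<eta>
  proof -
    obtain d where d: "d > 0"
      "\<And>z. norm (z - g x) < d \<Longrightarrow> norm (\<phi> z - \<phi> (g x) - \<phi>' (z - g x)) \<le> \<eta> * norm (z - g x)"
      using \<phi> \<open>\<eta> > 0\<close> unfolding has_derivative_at_alt by blast
    have "\<forall>\<^sub>F y in at x within S. dist (g y) (g x) < d"
      using g d(1) unfolding continuous_within tendsto_iff by blast
    then show ?thesis
      by eventually_elim (use d(2) in \<open>auto simp: R_def dist_norm\<close>)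
  qed
  have evF: "\<forall>\<^sub>F y in at x within S. norm (F y - F x - F' (y - x)) \<le> \<eta> * norm (y - x)" if "\<eta> > 0" for \<eta>
    using F that unfolding has_derivative_within_alt2 by blast
  fix e :: real assume "e > 0"
  \<comment> \<open>The two error terms at the end add up to
    \<open>\<eta> * C * norm (y - x)\<close>.\<close>
  define C where "C = K * (1 + 2 * K * (B + 1))"
  have "C > 0" unfolding C_def using K(1) B(1) by (intro mult_pos_pos add_pos_nonneg) auto
  define \<eta> where "\<eta> = e / C"
  have "\<eta> > 0" using \<open>e > 0\<close> \<open>C > 0\<close> by (simp add: \<eta>_def)
  \<comment> \<open>With this tolerance \<open>L (R y)\<close> has norm at most half of |g y - g x|
    and can be absorbed on the left.\<close>
  have K2: "1 / (2 * K) > 0" using K by simp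
  from evR[OF K2] evR[OF \<open>\<eta> > 0\<close>] evF[OF zero_less_one] evF[OF \<open>\<eta> > 0\<close>] eq(1)
  show "\<forall>\<^sub>F y in at x within S. norm (g y - g x - L (F' (y - x))) \<le> e * norm (y - x)"
  proof eventually_elim
    case (elim y)
    have eR: "R y = F y - F x - \<phi>' (g y - g x)"
      using elim(5) eq(2) by (simp add: R_def)
    have gy: "g y - g x = L (F y - F x) - L (R y)"
      unfolding eR by (simp add: L(2) flip: linear_diff[OF bounded_linear.linear[OF L(1)]])
    have "norm (F y - F x) \<le> norm (F y - F x - F' (y - x)) + norm (F' (y - x))"
      using norm_triangle_ineq[of "F y - F x - F' (y - x)" "F' (y - x)"] by simp
    also have "\<dots> \<le> (B + 1) * norm (y - x)"
      using elim(3) B(2)[of "y - x"] by (simp add: algebra_simps)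
    finally have dF: "norm (F y - F x) \<le> (B + 1) * norm (y - x)" .
    have "norm (L (R y)) \<le> norm (R y) * K" by (rule K(2))
    also have "\<dots> \<le> (1 / (2 * K) * norm (g y - g x)) * K"
      by (rule mult_right_mono[OF elim(1)]) (use K in simp)
    also have "\<dots> = norm (g y - g x) / 2" using K by simp
    finally have "norm (g y - g x) \<le> norm (F y - F x) * K + norm (g y - g x) / 2"
      using K(2)[of "F y - F x"] norm_triangle_ineq4[of "L (F y - F x)" "L (R y)"] unfolding gy[symmetric] by linarith
    then have "norm (g y - g x) \<le> 2 * K * norm (F y - F x)" by (simp add: algebra_simps)
    also have "\<dots> \<le> 2 * K * ((B + 1) * norm (y - x))"
      by (rule mult_left_mono[OF dF]) (use K in simp)
    finally have dg: "norm (g y - g x) \<le> 2 * K * (B + 1) * norm (y - x)" by simp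
    have "norm (L (R y)) \<le> norm (R y) * K" by (rule K(2))
    also have "\<dots> \<le> (\<eta> * (2 * K * (B + 1) * norm (y - x))) * K"
      by (intro mult_right_mono order_trans[OF elim(2)] mult_left_mono dg) (use K \<open>\<eta> > 0\<close> in auto)
    finally have 1: "norm (L (R y)) \<le> \<eta> * (2 * K * (B + 1) * norm (y - x)) * K" .
    have "norm (L (F y - F x - F' (y - x))) \<le> norm (F y - F x - F' (y - x)) * K" by (rule K(2))
    also have "\<dots> \<le> (\<eta> * norm (y - x)) * K"
      by (rule mult_right_mono[OF elim(4)]) (use K in simp)
    finally have 2: "norm (L (F y - F x - F' (y - x))) \<le> \<eta> * norm (y - x) * K" .
    have "g y - g x - L (F' (y - x)) = L (F y - F x - F' (y - x)) - L (R y)"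
      unfolding gy linear_diff[OF bounded_linear.linear[OF L(1)]] by simp
    then have "norm (g y - g x - L (F' (y - x))) \<le> \<eta> * norm (y - x) * K + \<eta> * (2 * K * (B + 1) * norm (y - x)) * K"
      using norm_triangle_ineq4[of "L (F y - F x - F' (y - x))" "L (R y)"] 1 2 by simp
    also have "\<dots> = \<eta> * C * norm (y - x)" by (simp add: C_def algebra_simps)
    also have "\<dots> = e * norm (y - x)" using \<open>C > 0\<close> by (simp add: \<eta>_def)
    finally show ?case .
  qed
qed

lemma differentiable_frechet: "f differentiable (at x) \<Longrightarrow> (f has_derivative frechet_derivative f (at x)) (at x)"
  by (simp add: frechet_derivative_works)

section \<open>Circulation densities of 1-forms\<close>

lemma has_integral_pd_segment:
  fixes F :: "real ^ 'n::finite \<Rightarrow> real"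
  assumes "\<And>t. t \<in> {0..1} \<Longrightarrow> F differentiable (at (x + (\<epsilon> * t) *\<^sub>R axis l 1))"
  shows "((\<lambda>t. \<epsilon> * pd l F (x + (\<epsilon> * t) *\<^sub>R axis l 1)) has_integral F (x + \<epsilon> *\<^sub>R axis l 1) - F x) {0..1}"
proof -
  have "((\<lambda>t. F (x + (\<epsilon> * t) *\<^sub>R axis l 1)) has_vector_derivative \<epsilon> * pd l F (x + (\<epsilon> * t) *\<^sub>R axis l 1))
      (at t within {0..1})" if t: "t \<in> {0..1}" for t
  proof -
    note F = differentiable_frechet[OF assms[OF t]]
    have *: "((\<lambda>t. x + (\<epsilon> * t) *\<^sub>R axis l 1) has_derivative (\<lambda>s. (\<epsilon> * s) *\<^sub>R axis l 1)) (at t within {0..1})"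
      by (auto intro!: derivative_eq_intros)
    have "((\<lambda>t. F (x + (\<epsilon> * t) *\<^sub>R axis l 1)) has_derivative
        (\<lambda>s. frechet_derivative F (at (x + (\<epsilon> * t) *\<^sub>R axis l 1)) ((\<epsilon> * s) *\<^sub>R axis l 1))) (at t within {0..1})"
      by (rule has_derivative_compose[OF * F])
    then show ?thesis
      unfolding has_vector_derivative_def pd_def
      by (simp add: linear_scale[OF has_derivative_linear[OF F]] mult_ac)
  qed
  from fundamental_theorem_of_calculus[OF zero_le_one this] show ?thesis by simp
qed

text \<open>The integrals of dF along the sides of a small square sum to zero, so both forms have
  equal circulation before any limit is taken. The fundamental theorem of calculus makes the
  derivatives of \<open>F\<close> integrable along segments without continuity.\<close>

lemma ext_deriv_add_exact:
  fixes F :: "real ^ 'n::finite \<Rightarrow> real"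
  assumes U: "open U" "u \<in> U" and F: "\<And>x. x \<in> U \<Longrightarrow> F differentiable (at x)"
    and \<eta>: "\<And>i. continuous_on U (\<eta> i)"
    and \<omega>: "\<And>i x. x \<in> U \<Longrightarrow> \<omega> i x = pd i F x + \<eta> i x"
  shows "ext_deriv \<omega> k l u = ext_deriv \<eta> k l u"
proof -
  obtain d where d: "d > 0" "ball u d \<subseteq> U"
    using U openE by blast
  have main: "circulation \<omega> k l u \<epsilon> = circulation \<eta> k l u \<epsilon>" if e: "\<bar>\<epsilon>\<bar> < d / 2" for \<epsilon>
  proof -
    have inU: "u + a *\<^sub>R axis i 1 + (\<epsilon> * t) *\<^sub>R axis j 1 \<in> U"
      if "t \<in> {0..1}" "\<bar>a\<bar> \<le> \<bar>\<epsilon>\<bar>" for a t and i j :: 'n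
    proof -
      have "norm (a *\<^sub>R axis i (1::real) + (\<epsilon> * t) *\<^sub>R axis j 1) \<le> \<bar>a\<bar> + \<bar>\<epsilon>\<bar> * \<bar>t\<bar>"
        by (rule norm_triangle_le) (simp add: norm_axis_1 abs_mult)
      also have "\<dots> \<le> \<bar>\<epsilon>\<bar> + \<bar>\<epsilon>\<bar> * 1"
        using that by (intro add_mono mult_left_mono) auto
      also have "\<dots> < d" using e by simp
      finally show ?thesis
        by (intro subsetD[OF d(2)]) (auto simp: dist_norm norm_minus_commute add.assoc
            norm_minus_cancel[of "_ + _", symmetric] simp del: norm_minus_cancel)
    qed
    have inU0: "u + (\<epsilon> * t) *\<^sub>R axis j 1 \<in> U" if "t \<in> {0..1}" for t and j :: 'n
      using inU[OF that, of 0 j j] by simp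
    have cont': "continuous_on {0..1} (\<lambda>t. \<eta> m (u + a *\<^sub>R axis i 1 + (\<epsilon> * t) *\<^sub>R axis j 1))"
      if "\<bar>a\<bar> \<le> \<bar>\<epsilon>\<bar>" for a m and i j :: 'n
      by (rule continuous_on_compose2[OF \<eta>]) (use inU that in \<open>auto intro!: continuous_intros\<close>)
    have ex: "((\<lambda>t. \<epsilon> * pd j F (u + a *\<^sub>R axis i 1 + (\<epsilon> * t) *\<^sub>R axis j 1)) has_integral
        F (u + a *\<^sub>R axis i 1 + \<epsilon> *\<^sub>R axis j 1) - F (u + a *\<^sub>R axis i 1)) {0..1}"
      if "\<bar>a\<bar> \<le> \<bar>\<epsilon>\<bar>" for a and i j :: 'n
      by (rule has_integral_pd_segment) (use inU that F in blast)
    define P where "P t =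
        (pd l F (u + \<epsilon> *\<^sub>R axis k 1 + (\<epsilon> * t) *\<^sub>R axis l 1) - pd l F (u + (\<epsilon> * t) *\<^sub>R axis l 1)) -
        (pd k F (u + \<epsilon> *\<^sub>R axis l 1 + (\<epsilon> * t) *\<^sub>R axis k 1) - pd k F (u + (\<epsilon> * t) *\<^sub>R axis k 1))" for t
    define Q where "Q t =
        (\<eta> l (u + \<epsilon> *\<^sub>R axis k 1 + (\<epsilon> * t) *\<^sub>R axis l 1) - \<eta> l (u + (\<epsilon> * t) *\<^sub>R axis l 1)) -
        (\<eta> k (u + \<epsilon> *\<^sub>R axis l 1 + (\<epsilon> * t) *\<^sub>R axis k 1) - \<eta> k (u + (\<epsilon> * t) *\<^sub>R axis k 1))" for t
    have "((\<lambda>t. (\<epsilon> * pd l F (u + \<epsilon> *\<^sub>R axis k 1 + (\<epsilon> * t) *\<^sub>R axis l 1)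
          - \<epsilon> * pd l F (u + 0 *\<^sub>R axis k 1 + (\<epsilon> * t) *\<^sub>R axis l 1)) -
        (\<epsilon> * pd k F (u + \<epsilon> *\<^sub>R axis l 1 + (\<epsilon> * t) *\<^sub>R axis k 1)
          - \<epsilon> * pd k F (u + 0 *\<^sub>R axis l 1 + (\<epsilon> * t) *\<^sub>R axis k 1))) has_integral
        ((F (u + \<epsilon> *\<^sub>R axis k 1 + \<epsilon> *\<^sub>R axis l 1) - F (u + \<epsilon> *\<^sub>R axis k 1)) -
         (F (u + 0 *\<^sub>R axis k 1 + \<epsilon> *\<^sub>R axis l 1) - F (u + 0 *\<^sub>R axis k 1))) -
        ((F (u + \<epsilon> *\<^sub>R axis l 1 + \<epsilon> *\<^sub>R axis k 1) - F (u + \<epsilon> *\<^sub>R axis l 1)) -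
         (F (u + 0 *\<^sub>R axis l 1 + \<epsilon> *\<^sub>R axis k 1) - F (u + 0 *\<^sub>R axis l 1)))) {0..1}"
      by (intro has_integral_diff ex) auto
    \<comment> \<open>The values of \<open>F\<close> at the four corners of the square
      cancel.\<close>
    then have intP: "((\<lambda>t. \<epsilon> * P t) has_integral 0) {0..1}"
      by (simp add: P_def[abs_def] algebra_simps)
    have "continuous_on {0..1} Q"
      unfolding Q_def
      using cont'[of \<epsilon> l k l] cont'[of 0 l k l] cont'[of \<epsilon> k l k] cont'[of 0 k l k]
      by (intro continuous_on_diff) simp_all
    then have "(Q has_integral integral {0..1} Q) {0..1}"
      by (simp add: integrable_continuous_real integrable_integral)
    then have "((\<lambda>t. \<epsilon> * Q t) has_integral \<epsilon> * integral {0..1} Q) {0..1}"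
      by (rule has_integral_mult_right)
    from has_integral_add[OF intP this]
    have "((\<lambda>t. \<epsilon> * (P t + Q t)) has_integral \<epsilon> * integral {0..1} Q) {0..1}"
      by (simp add: distrib_left)
    then have "\<epsilon> * integral {0..1} (\<lambda>t. P t + Q t) = \<epsilon> * integral {0..1} Q"
      by (metis integral_mult_right integral_unique)
    moreover have "integral {0..1} (\<lambda>t. P t + Q t) = integral {0..1} (\<lambda>t.
        (\<omega> l (u + \<epsilon> *\<^sub>R axis k 1 + (\<epsilon> * t) *\<^sub>R axis l 1) - \<omega> l (u + (\<epsilon> * t) *\<^sub>R axis l 1)) -
        (\<omega> k (u + \<epsilon> *\<^sub>R axis l 1 + (\<epsilon> * t) *\<^sub>R axis k 1) - \<omega> k (u + (\<epsilon> * t) *\<^sub>R axis k 1)))"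
      by (rule integral_cong) (simp add: P_def Q_def \<omega> inU inU0)
    ultimately show ?thesis
      unfolding circulation_def Q_def by simp
  qed
  have "\<forall>\<^sub>F \<epsilon> in at 0. circulation \<omega> k l u \<epsilon> / \<epsilon>\<^sup>2 = circulation \<eta> k l u \<epsilon> / \<epsilon>\<^sup>2"
    unfolding eventually_at using main d by (auto intro!: exI[of _ "d / 2"])
  then show ?thesis
    unfolding ext_deriv_def by (rule Lim_cong) simp_all
qed

text \<open>The form \<open>pd i F x \<bullet> (G x - G u)\<close> left after removing the exact
  part is a continuous factor times one vanishing at \<open>u\<close>, hence differentiable at
  \<open>u\<close> without a second derivative of \<open>F\<close>. There
  \<open>ext_deriv_differentiable\<close> applies.\<close>

lemma ext_deriv_inner:
  fixes F G :: "real ^ 'n::finite \<Rightarrow> 'b::real_inner"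
  assumes U: "open U" "u \<in> U" and F: "\<And>x. x \<in> U \<Longrightarrow> F differentiable (at x)"
    and F1: "\<And>i. continuous_on U (pd i F)"
    and G: "continuous_on U G" "(G has_derivative G') (at u)"
    and \<omega>: "\<And>i x. x \<in> U \<Longrightarrow> \<omega> i x = pd i F x \<bullet> G x"
  shows "ext_deriv \<omega> k l u = pd l F u \<bullet> G' (axis k 1) - pd k F u \<bullet> G' (axis l 1)"
proof -
  have pdF: "pd i (\<lambda>x. F x \<bullet> G u) x = pd i F x \<bullet> G u" if "x \<in> U" for i x
  proof -
    have "((\<lambda>x. F x \<bullet> G u) has_derivative (\<lambda>h. frechet_derivative F (at x) h \<bullet> G u)) (at x)"
      by (intro has_derivative_inner_left differentiable_frechet F that)
    then show ?thesis by (simp add: pd_def frechet_derivative_at[symmetric])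
  qed
  have cont: "continuous_on U (\<lambda>x. pd i F x \<bullet> (G x - G u))" for i
    by (intro continuous_intros F1 G)
  have der: "((\<lambda>x. pd i F x \<bullet> (G x - G u)) has_derivative (\<lambda>v. pd i F u \<bullet> G' v)) (at u)" for i
  proof (rule has_derivative_inner_vanishing)
    show "continuous (at u) (pd i F)"
      using F1 U continuous_on_eq_continuous_at by blast
    show "((\<lambda>x. G x - G u) has_derivative G') (at u)"
      using has_derivative_diff[OF G(2) has_derivative_const[of "G u"]] by simp
  qed simp
  have "ext_deriv \<omega> k l u = ext_deriv (\<lambda>i x. pd i F x \<bullet> (G x - G u)) k l u"
  proof (rule ext_deriv_add_exact[OF U])
    show "(\<lambda>x. F x \<bullet> G u) differentiable (at x)" if "x \<in> U" for x
      using has_derivative_inner_left[OF differentiable_frechet[OF F[OF that]]]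
      by (rule differentiableI)
  qed (use cont in \<open>auto simp: \<omega> pdF inner_diff_right\<close>)
  also have "\<dots> = pd k (\<lambda>x. pd l F x \<bullet> (G x - G u)) u - pd l (\<lambda>x. pd k F x \<bullet> (G x - G u)) u"
    by (rule ext_deriv_differentiable[OF U cont]) (use der in \<open>auto simp: differentiable_def\<close>)
  also have "\<dots> = pd l F u \<bullet> G' (axis k 1) - pd k F u \<bullet> G' (axis l 1)"
    unfolding pd_def[of _ "\<lambda>x. _ x \<bullet> _ x"] frechet_derivative_at[OF der, symmetric] ..
  finally show ?thesis .
qed

section \<open>Functions of class C^k\<close>

lemma Ck_on_Suc_imp: "Ck_on (Suc k) U f \<Longrightarrow> Ck_on k U f"
proof (induction k arbitrary: f)
  case 0
  then show ?case
    by (auto simp: differentiable_imp_continuous_within continuous_on_eq_continuous_within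
        intro: continuous_at_imp_continuous_at_within)
qed auto

lemma Ck_on_mono: "m \<le> k \<Longrightarrow> Ck_on k U f \<Longrightarrow> Ck_on m U f"
  by (induction k rule: dec_induct) (use Ck_on_Suc_imp in blast)+

lemma Ck_on_1_iff:
  "Ck_on 1 U f \<longleftrightarrow> (\<forall>x\<in>U. f differentiable (at x)) \<and> (\<forall>v. continuous_on U (\<lambda>x. frechet_derivative f (at x) v))"
  by (simp add: One_nat_def)

lemma Ck_on_pd: "Ck_on (Suc k) U f \<Longrightarrow> Ck_on k U (pd i f)"
  by (simp add: pd_def[abs_def])

lemma Ck_on_differentiable: "Ck_on k U f \<Longrightarrow> 0 < k \<Longrightarrow> x \<in> U \<Longrightarrow> f differentiable (at x)"
  by (cases k) auto

lemma Ck_on_continuous: "Ck_on k U f \<Longrightarrow> continuous_on U f"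
  using Ck_on_mono[of 0 k U f] by simp

text \<open>\<open>pd k (pd l f) u - pd l (pd k f) u\<close> is the circulation density of the exact form \<open>df\<close>.\<close>

lemma pd_commute:
  fixes f :: "real ^ 'n::finite \<Rightarrow> 'b::real_inner"
  assumes U: "open U" "u \<in> U" and f: "Ck_on 2 U f"
  shows "pd k (pd l f) u = pd l (pd k f) u"
proof -
  have f': "Ck_on (Suc 1) U f" using f by (simp add: numeral_2_eq_2)
  have C1: "Ck_on 1 U (pd i f)" for i by (rule Ck_on_pd[OF f'])
  have diff: "pd i f differentiable (at u)" for i
    using Ck_on_differentiable[OF C1] U by simp
  have der: "((\<lambda>x. pd i f x \<bullet> c) has_derivative (\<lambda>h. frechet_derivative (pd i f) (at u) h \<bullet> c)) (at u)" for i c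
    by (intro has_derivative_inner_left differentiable_frechet diff)
  have "(pd k (pd l f) u - pd l (pd k f) u) \<bullet> c = 0" for c
  proof -
    have "ext_deriv (\<lambda>i x. pd i f x \<bullet> c) k l u = pd l f u \<bullet> 0 - pd k f u \<bullet> 0"
      by (rule ext_deriv_inner[where G = "\<lambda>_. c" and G' = "\<lambda>_. 0", OF U])
        (use f' Ck_on_continuous[OF C1] in auto)
    moreover have "ext_deriv (\<lambda>i x. pd i f x \<bullet> c) k l u
        = pd k (\<lambda>x. pd l f x \<bullet> c) u - pd l (\<lambda>x. pd k f x \<bullet> c) u"
      by (rule ext_deriv_differentiable[OF U])
        (use der in \<open>auto simp: differentiable_def intro!: continuous_on_inner Ck_on_continuous[OF C1]\<close>)
    moreover have "pd i (\<lambda>x. pd j f x \<bullet> c) u = pd i (pd j f) u \<bullet> c" for i j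
      unfolding pd_def[of i] frechet_derivative_at[OF der, symmetric] ..
    ultimately show ?thesis by (simp add: inner_diff_left)
  qed
  from this[of "pd k (pd l f) u - pd l (pd k f) u"] show ?thesis by simp
qed


section \<open>Gauss' equation for immersed hypersurfaces\<close>

lemma linear_sum_axis:
  fixes D :: "real ^ 'n::finite \<Rightarrow> 'b::real_vector"
  assumes "linear D"
  shows "D v = (\<Sum>i\<in>UNIV. v $ i *\<^sub>R D (axis i 1))"
proof -
  have "D v = D (\<Sum>i\<in>UNIV. v $ i *\<^sub>R axis i 1)"
    using basis_expansion[of v] by (simp add: scalar_mult_eq_scaleR)
  then show ?thesis
    by (simp add: linear_sum[OF assms] linear_scale[OF assms])
qed

lemma frechet_derivative_sum_pd:
  assumes "f differentiable (at x)"
  shows "frechet_derivative f (at x) v = (\<Sum>i\<in>UNIV. v $ i *\<^sub>R pd i f x)"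
  unfolding pd_def using linear_sum_axis linear_frechet_derivative assms by blast

text \<open>The domain of \<open>T\<close> is the ambient type itself, so injectivity of this linear
  endomorphism already gives surjectivity.\<close>

lemma hyperplane_decomp:
  fixes D :: "real ^ 'n::finite \<Rightarrow> 'n ambient"
  assumes D: "linear D" "inj D" and N: "N \<noteq> 0" "\<And>c. D c \<bullet> N = 0"
  obtains c s where "y = D c + s *\<^sub>R N"
proof -
  define T where "T z = D (fst z) + snd z *\<^sub>R N" for z
  have T: "linear T"
    unfolding T_def
    by (rule linearI) (simp_all add: linear_add[OF D(1)] linear_scale[OF D(1)] algebra_simps)
  have "inj T"
    unfolding linear_injective_0[OF T]
  proof (intro allI impI)
    fix z assume z: "T z = 0"
    then have "T z \<bullet> N = 0" by simp
    then have "snd z = 0" by (simp add: T_def inner_add_left N)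
    with z have "D (fst z) = 0" by (simp add: T_def)
    then have "fst z = 0" using D linear_injective_0 by blast
    then show "z = 0" using \<open>snd z = 0\<close> by (simp add: prod_eq_iff)
  qed
  then have "surj T" using T by (simp add: linear_injective_imp_surjective)
  then obtain z where "y = T z" by (metis surjD)
  then show thesis using that T_def by blast
qed

text \<open>The vectors \<open>D (axis i 1)\<close> and \<open>N\<close> span the ambient space, so
  every component of \<open>F\<close> is a fixed linear combination of the given ones.\<close>

lemma differentiable_hyperplane:
  fixes F :: "'a::euclidean_space \<Rightarrow> 'n::finite ambient" and D :: "real ^ 'n \<Rightarrow> 'n ambient"
  assumes D: "linear D" "inj D" and N: "N \<noteq> 0" "\<And>c. D c \<bullet> N = 0"
    and F: "\<And>i. (\<lambda>x. F x \<bullet> D (axis i 1)) differentiable (at u)" "(\<lambda>x. F x \<bullet> N) differentiable (at u)"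
  shows "F differentiable (at u)"
  unfolding differentiable_componentwise_within[of F]
proof
  fix b :: "'n ambient"
  obtain c s where b: "b = D c + s *\<^sub>R N" by (rule hyperplane_decomp[OF D N])
  have "(\<lambda>x. F x \<bullet> b) = (\<lambda>x. (\<Sum>i\<in>UNIV. c $ i * (F x \<bullet> D (axis i 1))) + s * (F x \<bullet> N))"
    unfolding b linear_sum_axis[OF D(1), of c] by (simp add: inner_add_right inner_sum_right)
  moreover have "\<dots> differentiable (at u)"
    by (intro differentiable_add differentiable_sum ballI differentiable_mult differentiable_const F) simp
  ultimately show "(\<lambda>x. F x \<bullet> b) differentiable (at u)" by simp
qed

section \<open>Inverses of matrix-valued functions\<close>

lemma matrix_inv_eq:
  fixes A B :: "real ^ 'n::finite ^ 'n"
  assumes "A ** B = mat 1"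
  shows "matrix_inv A = B"
proof -
  have BA: "B ** A = mat 1" using assms matrix_left_right_inverse by blast
  have "A ** matrix_inv A = mat 1 \<and> matrix_inv A ** A = mat 1"
    unfolding matrix_inv_def by (rule someI[of _ B]) (use assms BA in blast)
  then show ?thesis using BA by (metis matrix_mul_assoc matrix_mul_lid matrix_mul_rid)
qed

lemma continuous_on_det:
  fixes A :: "'a::topological_space \<Rightarrow> real ^ 'n::finite ^ 'n"
  assumes "\<And>i j. continuous_on U (\<lambda>x. A x $ i $ j)"
  shows "continuous_on U (\<lambda>x. det (A x))"
  unfolding det_def by (intro continuous_intros assms)

text \<open>By Cramer's rule an entry of the inverse is a quotient of determinants, which are
  polynomials in the entries.\<close>

lemma continuous_on_matrix_inv:
  fixes A :: "'a::topological_space \<Rightarrow> real ^ 'n::finite ^ 'n"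
  assumes A: "\<And>i j. continuous_on U (\<lambda>x. A x $ i $ j)" and inv: "\<And>x. x \<in> U \<Longrightarrow> invertible (A x)"
  shows "continuous_on U (\<lambda>x. matrix_inv (A x) $ m $ q)"
proof -
  have eq: "matrix_inv (A x) $ m $ q = det (\<chi> i j. if j = m then axis q 1 $ i else A x $ i $ j) / det (A x)"
    if "x \<in> U" for x
  proof -
    have d: "det (A x) \<noteq> 0" using inv[OF that] by (simp add: invertible_det_nz)
    have "A x ** matrix_inv (A x) = mat 1"
      using inv[OF that] matrix_inv_eq by (metis invertible_def)
    then have "A x *v (matrix_inv (A x) *v axis q 1) = axis q 1"
      by (simp add: matrix_vector_mul_assoc)
    then have "matrix_inv (A x) *v axis q 1
        = (\<chi> k. det (\<chi> i j. if j = k then axis q 1 $ i else A x $ i $ j) / det (A x))"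
      using cramer[OF d] by blast
    then show ?thesis
      by (simp add: vec_eq_iff matrix_vector_mult_basis column_def)
  qed
  have "continuous_on U (\<lambda>x. det (\<chi> i j. if j = m then axis q 1 $ i else A x $ i $ j) / det (A x))"
  proof (intro continuous_on_divide continuous_on_det A ballI)
    fix i j
    show "continuous_on U (\<lambda>x. (\<chi> i j. if j = m then axis q 1 $ i else A x $ i $ j) $ i $ j)"
      by (cases "j = m") (simp_all add: A)
  next
    fix x assume "x \<in> U"
    then show "det (A x) \<noteq> 0" using inv by (simp add: invertible_det_nz)
  qed
  then show ?thesis by (rule continuous_on_eq) (simp add: eq)
qed

text \<open>For an immersion this is the reciprocal basis of the tangent space: the tangent vector
  pairing to 1 with \<open>pd m \<phi> x\<close> and to 0 with the other coordinate vectors.\<close>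

definition dual_frame :: "(real ^ 'n \<Rightarrow> 'b::real_inner) \<Rightarrow> 'n::finite \<Rightarrow> real ^ 'n \<Rightarrow> 'b" where
  "dual_frame \<phi> m x = (\<Sum>q\<in>UNIV. matrix_inv (induced_metric \<phi> x) $ m $ q *\<^sub>R pd q \<phi> x)"

section \<open>Metric and Christoffel symbols of a C^2 immersion\<close>

locale immersion =
  fixes \<phi> :: "real ^ 'n::finite \<Rightarrow> 'n ambient" and U :: "(real ^ 'n) set"
  assumes open_U: "open U" and C2: "Ck_on 2 U \<phi>"
    and inj: "\<And>x. x \<in> U \<Longrightarrow> inj (frechet_derivative \<phi> (at x))"
begin

lemma differentiable: "x \<in> U \<Longrightarrow> \<phi> differentiable (at x)"
  using Ck_on_differentiable[OF C2] by simp

lemma C1_pd: "Ck_on 1 U (pd i \<phi>)"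
  by (rule Ck_on_pd) (use C2 in \<open>simp add: numeral_2_eq_2\<close>)

lemma pd_differentiable: "x \<in> U \<Longrightarrow> pd i \<phi> differentiable (at x)"
  using Ck_on_differentiable[OF C1_pd] by simp

lemma continuous_on_pd: "continuous_on U (pd i \<phi>)"
  by (rule Ck_on_continuous[OF C1_pd])

lemma linear_deriv: "x \<in> U \<Longrightarrow> linear (frechet_derivative \<phi> (at x))"
  by (rule linear_frechet_derivative[OF differentiable])

lemma deriv_axis: "frechet_derivative \<phi> (at x) (axis i 1) = pd i \<phi> x"
  by (simp add: pd_def)

text \<open>The quadratic form of this Gram matrix is |d\<phi> v|^2, so a vector in its kernel is
  killed by the injective differential.\<close>

lemma invertible_induced_metric:
  assumes x: "x \<in> U"
  shows "invertible (induced_metric \<phi> x)"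
  unfolding invertible_left_inverse matrix_left_invertible_ker
proof (intro allI impI)
  fix v assume v: "induced_metric \<phi> x *v v = 0"
  let ?D = "frechet_derivative \<phi> (at x) v"
  have D: "?D = (\<Sum>k\<in>UNIV. v $ k *\<^sub>R pd k \<phi> x)"
    by (rule frechet_derivative_sum_pd[OF differentiable[OF x]])
  have "pd j \<phi> x \<bullet> ?D = (induced_metric \<phi> x *v v) $ j" for j
    unfolding D by (simp add: matrix_vector_mult_def induced_metric_def inner_sum_right mult.commute)
  then have "?D \<bullet> ?D = 0"
    using v by (subst (1) D) (simp add: inner_sum_left)
  then have "?D = 0" by simp
  then show "v = 0"
    using inj[OF x] linear_injective_0[OF linear_deriv[OF x]] by blast
qed

lemma dual_frame_pd:
  assumes x: "x \<in> U"
  shows "dual_frame \<phi> m x \<bullet> pd p \<phi> x = (if m = p then 1 else 0)"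
proof -
  have "matrix_inv (induced_metric \<phi> x) ** induced_metric \<phi> x = mat 1"
    using invertible_induced_metric[OF x] matrix_inv_eq by (metis invertible_def)
  then have "(matrix_inv (induced_metric \<phi> x) ** induced_metric \<phi> x) $ m $ p = (if m = p then 1 else 0)"
    by (simp add: mat_def)
  then show ?thesis
    by (simp add: matrix_matrix_mult_def dual_frame_def inner_sum_left induced_metric_def)
qed

lemma continuous_on_metric_inv:
  "continuous_on U (\<lambda>x. matrix_inv (induced_metric \<phi> x) $ m $ q)"
  by (rule continuous_on_matrix_inv)
    (auto simp: induced_metric_def invertible_induced_metric[unfolded induced_metric_def]
      intro!: continuous_on_inner continuous_on_pd)

lemma continuous_on_dual_frame: "continuous_on U (dual_frame \<phi> m)"
  unfolding dual_frame_def[abs_def]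
  by (intro continuous_on_sum continuous_on_scaleR continuous_on_metric_inv continuous_on_pd)

lemma pd_induced_metric:
  assumes x: "x \<in> U"
  shows "pd k (\<lambda>x. induced_metric \<phi> x $ j $ l) x = pd k (pd j \<phi>) x \<bullet> pd l \<phi> x + pd j \<phi> x \<bullet> pd k (pd l \<phi>) x"
proof -
  note d = differentiable_frechet[OF pd_differentiable[OF x]]
  have "((\<lambda>x. pd j \<phi> x \<bullet> pd l \<phi> x) has_derivative
      (\<lambda>h. pd j \<phi> x \<bullet> frechet_derivative (pd l \<phi>) (at x) h + frechet_derivative (pd j \<phi>) (at x) h \<bullet> pd l \<phi> x)) (at x)"
    by (rule has_derivative_inner[OF d d])
  then show ?thesis
    by (simp add: induced_metric_def pd_def[of k] frechet_derivative_at[symmetric])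
qed

text \<open>Of the six terms produced by differentiating the metric, four cancel by symmetry of
  second derivatives and the remaining two coincide; raising the index turns
  \<open>pd l \<phi>\<close> into the dual frame.\<close>

lemma christoffel_eq:
  assumes x: "x \<in> U"
  shows "christoffel (induced_metric \<phi>) m k j x = pd k (pd j \<phi>) x \<bullet> dual_frame \<phi> m x"
proof -
  note sym = pd_commute[OF open_U x C2]
  have "(pd k (\<lambda>x. induced_metric \<phi> x $ j $ l) x + pd j (\<lambda>x. induced_metric \<phi> x $ k $ l) x
      - pd l (\<lambda>x. induced_metric \<phi> x $ k $ j) x) = 2 * (pd k (pd j \<phi>) x \<bullet> pd l \<phi> x)" for l
    unfolding pd_induced_metric[OF x] sym[of j k] sym[of l k] sym[of l j]
    by (simp add: inner_commute)
  then show ?thesis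
    by (simp add: christoffel_def dual_frame_def inner_sum_right sum_distrib_left sum_divide_distrib mult_ac)
qed

end

section \<open>Gauss' equation and its contraction at one point\<close>

locale immersion_normal = immersion \<phi> U for \<phi> :: "real ^ 'n::finite \<Rightarrow> 'n ambient" and U +
  fixes u :: "real ^ 'n" and N :: "'n ambient"
  assumes u: "u \<in> U" and norm_N: "N \<bullet> N = 1" and normal: "\<And>j. pd j \<phi> u \<bullet> N = 0"
begin

text \<open>The second fundamental form at \<open>u\<close>. It differentiates the tangent frame
  only, so \<open>N\<close> is a single vector and not a normal field.\<close>

definition "h j l = pd j (pd l \<phi>) u \<bullet> N"

lemma h_commute: "h j l = h l j"
  unfolding h_def using pd_commute[OF open_U u C2] by simp

lemma deriv_normal: "frechet_derivative \<phi> (at u) c \<bullet> N = 0"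
  unfolding frechet_derivative_sum_pd[OF differentiable[OF u]] by (simp add: inner_sum_left normal)

lemma N_nonzero: "N \<noteq> 0"
  using norm_N by auto

lemma dual_frame_normal: "dual_frame \<phi> m u \<bullet> N = 0"
  by (simp add: dual_frame_def inner_sum_left normal)

text \<open>The dual frame reads off the tangential coefficients of \<open>y\<close> in the basis
  formed by \<open>pd p \<phi> u\<close> and \<open>N\<close>.\<close>

lemma inner_expansion:
  "y \<bullet> v = (\<Sum>p\<in>UNIV. (y \<bullet> dual_frame \<phi> p u) * (pd p \<phi> u \<bullet> v)) + (y \<bullet> N) * (N \<bullet> v)"
proof -
  obtain c s where y: "y = frechet_derivative \<phi> (at u) c + s *\<^sub>R N"
    using hyperplane_decomp[OF linear_deriv[OF u] inj[OF u] N_nonzero deriv_normal] by blast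
  have yN: "y \<bullet> N = s" by (simp add: y inner_add_left deriv_normal norm_N)
  have D: "frechet_derivative \<phi> (at u) c = (\<Sum>q\<in>UNIV. c $ q *\<^sub>R pd q \<phi> u)"
    by (rule frechet_derivative_sum_pd[OF differentiable[OF u]])
  have yp: "y \<bullet> dual_frame \<phi> p u = c $ p" for p
    unfolding y D inner_commute[of _ "dual_frame \<phi> p u"]
    by (simp add: inner_add_right inner_sum_right dual_frame_pd[OF u] dual_frame_normal if_distrib cong: if_cong)
  show ?thesis
    unfolding yN yp by (simp add: y D inner_add_left inner_sum_left)
qed

text \<open>Differentiability is tested against the basis \<open>pd p \<phi> u\<close>,
  \<open>N\<close>. Tangentially, constancy of
  \<open>dual_frame \<phi> m x \<bullet> pd p \<phi> x\<close> moves the increment onto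
  \<open>pd p \<phi>\<close>; along \<open>N\<close>, the factors
  \<open>pd q \<phi> x \<bullet> N\<close> vanish at \<open>u\<close>. In both cases the other
  factor enters only through its continuity.\<close>

lemma dual_frame_derivative:
  obtains B' where "(dual_frame \<phi> m has_derivative B') (at u)"
    "\<And>k p. pd p \<phi> u \<bullet> B' (axis k 1) = - christoffel (induced_metric \<phi>) m k p u"
    "\<And>k. N \<bullet> B' (axis k 1) = (\<Sum>q\<in>UNIV. matrix_inv (induced_metric \<phi> u) $ m $ q * h k q)"
proof -
  let ?B = "dual_frame \<phi> m"
  have cont: "continuous (at u) f" if "continuous_on U f" for f :: "real ^ 'n \<Rightarrow> 'c::topological_space"
    using that open_U u continuous_on_eq_continuous_at by blast
  have vd: "((\<lambda>x. pd p \<phi> x - pd p \<phi> u) has_derivative frechet_derivative (pd p \<phi>) (at u)) (at u)" for p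
    using has_derivative_diff[OF differentiable_frechet[OF pd_differentiable[OF u]] has_derivative_const]
    by simp
  have "((\<lambda>x. ?B x \<bullet> (pd p \<phi> x - pd p \<phi> u)) has_derivative (\<lambda>v. ?B u \<bullet> frechet_derivative (pd p \<phi>) (at u) v)) (at u)" for p
    by (rule has_derivative_inner_vanishing[OF cont[OF continuous_on_dual_frame] vd]) simp
  from has_derivative_diff[OF has_derivative_const this]
  have "((\<lambda>x. (if m = p then 1 else 0) - ?B x \<bullet> (pd p \<phi> x - pd p \<phi> u)) has_derivative
      (\<lambda>v. - (?B u \<bullet> frechet_derivative (pd p \<phi>) (at u) v))) (at u)" for p
    by simp
  then have 1: "((\<lambda>x. ?B x \<bullet> pd p \<phi> u) has_derivative (\<lambda>v. - (?B u \<bullet> frechet_derivative (pd p \<phi>) (at u) v))) (at u)" for p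
    by (rule has_derivative_transform_within_open[OF _ open_U u]) (simp add: dual_frame_pd inner_diff_right)
  have "((\<lambda>x. pd q \<phi> x \<bullet> N) has_derivative (\<lambda>v. frechet_derivative (pd q \<phi>) (at u) v \<bullet> N)) (at u)" for q
    by (intro has_derivative_inner_left differentiable_frechet pd_differentiable u)
  then have "((\<lambda>x. matrix_inv (induced_metric \<phi> x) $ m $ q *\<^sub>R (pd q \<phi> x \<bullet> N)) has_derivative
      (\<lambda>v. matrix_inv (induced_metric \<phi> u) $ m $ q *\<^sub>R (frechet_derivative (pd q \<phi>) (at u) v \<bullet> N))) (at u)" for q
    by (rule has_derivative_scaleR_vanishing[OF cont[OF continuous_on_metric_inv]]) (rule normal)
  then have 2: "((\<lambda>x. ?B x \<bullet> N) has_derivative (\<lambda>v. \<Sum>q\<in>UNIV. matrix_inv (induced_metric \<phi> u) $ m $ q *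
      (frechet_derivative (pd q \<phi>) (at u) v \<bullet> N))) (at u)"
    unfolding dual_frame_def inner_sum_left inner_scaleR_left by (intro has_derivative_sum) simp
  have "?B differentiable (at u)"
    by (rule differentiable_hyperplane[OF linear_deriv[OF u] inj[OF u] N_nonzero deriv_normal])
      (use 1 2 in \<open>auto simp: differentiable_def deriv_axis\<close>)
  then obtain B' where B': "(?B has_derivative B') (at u)" by (auto simp: differentiable_def)
  then have B'c: "((\<lambda>x. ?B x \<bullet> c) has_derivative (\<lambda>v. B' v \<bullet> c)) (at u)" for c
    by (rule has_derivative_inner_left)
  show thesis
  proof (rule that[OF B'])
    show "pd p \<phi> u \<bullet> B' (axis k 1) = - christoffel (induced_metric \<phi>) m k p u" for k p
      using fun_cong[OF has_derivative_unique[OF B'c 1[of p]], of "axis k 1"]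
      unfolding christoffel_eq[OF u] pd_def[of k] by (simp add: inner_commute)
    show "N \<bullet> B' (axis k 1) = (\<Sum>q\<in>UNIV. matrix_inv (induced_metric \<phi> u) $ m $ q * h k q)" for k
      using fun_cong[OF has_derivative_unique[OF B'c 2], of "axis k 1"]
      unfolding h_def pd_def[of k] by (simp add: inner_commute)
  qed
qed

text \<open>Gauss' equation. In the density given by \<open>ext_deriv_inner\<close>, the tangential
  parts of the second derivatives of \<open>\<phi>\<close> contribute the negative of the quadratic
  Christoffel terms in \<open>riemann\<close>; the normal parts remain.\<close>

lemma riemann_eq:
  "riemann (induced_metric \<phi>) m j k l u =
     h l j * (\<Sum>q\<in>UNIV. matrix_inv (induced_metric \<phi> u) $ m $ q * h k q)
     - h k j * (\<Sum>q\<in>UNIV. matrix_inv (induced_metric \<phi> u) $ m $ q * h l q)"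
proof -
  let ?\<Gamma> = "\<lambda>m k j. christoffel (induced_metric \<phi>) m k j u"
  obtain B' where B': "(dual_frame \<phi> m has_derivative B') (at u)"
    "\<And>k p. pd p \<phi> u \<bullet> B' (axis k 1) = - ?\<Gamma> m k p"
    "\<And>k. N \<bullet> B' (axis k 1) = (\<Sum>q\<in>UNIV. matrix_inv (induced_metric \<phi> u) $ m $ q * h k q)"
    using dual_frame_derivative[of m] by blast
  have "continuous_on U (pd i (pd j \<phi>))" for i
    using C1_pd by (simp add: Ck_on_1_iff pd_def[of i])
  then have "ext_deriv (\<lambda>i. christoffel (induced_metric \<phi>) m i j) k l u
      = pd l (pd j \<phi>) u \<bullet> B' (axis k 1) - pd k (pd j \<phi>) u \<bullet> B' (axis l 1)"
    by (intro ext_deriv_inner[OF open_U u, where G = "dual_frame \<phi> m"] pd_differentiable continuous_on_dual_frame B'(1) christoffel_eq)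
  moreover have "pd l (pd j \<phi>) u \<bullet> B' (axis k 1) =
      - (\<Sum>p\<in>UNIV. ?\<Gamma> m k p * ?\<Gamma> p l j)
      + h l j * (\<Sum>q\<in>UNIV. matrix_inv (induced_metric \<phi> u) $ m $ q * h k q)" for k l
    unfolding inner_expansion[of "pd l (pd j \<phi>) u" "B' (axis k 1)"] B'
    by (simp add: christoffel_eq[OF u] h_def sum_negf mult.commute)
  ultimately show ?thesis
    unfolding riemann_def by (simp add: sum_subtractf)
qed

text \<open>The second fundamental form on arbitrary coordinate vectors. Keeping \<open>b\<close>
  fixed while differentiating gives the form in which it arises from the orthogonality of a normal
  field to d\<phi> b.\<close>

definition hess where
  "hess a b = frechet_derivative (\<lambda>x. frechet_derivative \<phi> (at x) b) (at u) a \<bullet> N"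

lemma hess_sum: "hess a b = (\<Sum>j\<in>UNIV. \<Sum>l\<in>UNIV. a $ j * b $ l * h j l)"
proof -
  have "((\<lambda>x. \<Sum>l\<in>UNIV. b $ l *\<^sub>R pd l \<phi> x) has_derivative
      (\<lambda>v. \<Sum>l\<in>UNIV. b $ l *\<^sub>R frechet_derivative (pd l \<phi>) (at u) v)) (at u)"
    by (intro has_derivative_sum has_derivative_scaleR_right differentiable_frechet pd_differentiable u)
  then have "((\<lambda>x. frechet_derivative \<phi> (at x) b) has_derivative
      (\<lambda>v. \<Sum>l\<in>UNIV. b $ l *\<^sub>R frechet_derivative (pd l \<phi>) (at u) v)) (at u)"
    by (rule has_derivative_transform_within_open[OF _ open_U u])
      (simp add: frechet_derivative_sum_pd[OF differentiable])
  then have "frechet_derivative (\<lambda>x. frechet_derivative \<phi> (at x) b) (at u) a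
      = (\<Sum>l\<in>UNIV. b $ l *\<^sub>R frechet_derivative (pd l \<phi>) (at u) a)"
    by (simp add: frechet_derivative_at[symmetric])
  also have "\<dots> = (\<Sum>l\<in>UNIV. b $ l *\<^sub>R (\<Sum>j\<in>UNIV. a $ j *\<^sub>R pd j (pd l \<phi>) u))"
    by (simp add: frechet_derivative_sum_pd[OF pd_differentiable[OF u]])
  finally show ?thesis
    unfolding hess_def
    by (simp add: inner_sum_left h_def sum_distrib_left mult_ac) (rule sum.swap)
qed

lemma hess_commute: "hess a b = hess b a"
  unfolding hess_sum by (subst sum.swap) (simp add: h_commute mult_ac)

text \<open>With the coordinates of the frame as rows of \<open>P\<close>, orthonormality reads P g
  P^T = 1, so the inverse of g is P^T P.\<close>

lemma matrix_inv_orthonormal: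
  fixes b :: "'n \<Rightarrow> real ^ 'n"
  assumes b: "\<And>k l. frechet_derivative \<phi> (at u) (b k) \<bullet> frechet_derivative \<phi> (at u) (b l) = (if k = l then 1 else 0)"
  shows "matrix_inv (induced_metric \<phi> u) $ m $ q = (\<Sum>k\<in>UNIV. b k $ m * b k $ q)"
proof -
  define P :: "real ^ 'n ^ 'n" where "P = (\<chi> k m. b k $ m)"
  let ?g = "induced_metric \<phi> u"
  have "(P ** (?g ** transpose P)) $ k $ l = frechet_derivative \<phi> (at u) (b k) \<bullet> frechet_derivative \<phi> (at u) (b l)" for k l
    unfolding frechet_derivative_sum_pd[OF differentiable[OF u]]
    by (simp add: P_def matrix_matrix_mult_def transpose_def induced_metric_def inner_sum_left inner_sum_right
        sum_distrib_left mult_ac) (rule sum.swap)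
  then have "P ** (?g ** transpose P) = mat 1"
    by (simp add: b vec_eq_iff mat_def)
  then have "(?g ** transpose P) ** P = mat 1"
    using matrix_left_right_inverse by blast
  then have "matrix_inv ?g = transpose P ** P"
    by (intro matrix_inv_eq) (simp add: matrix_mul_assoc)
  then show ?thesis
    by (simp add: P_def matrix_matrix_mult_def transpose_def)
qed

text \<open>The contracted Gauss equation Ric(a,a) = tr(h) h(a,a) - |h(a,.)|^2, with trace and norm
  taken in the orthonormal frame \<open>b\<close>. Beyond \<open>riemann_eq\<close> it is a
  reordering of sums.\<close>

lemma ricci_eq:
  fixes b :: "'n \<Rightarrow> real ^ 'n"
  assumes b: "\<And>k l. frechet_derivative \<phi> (at u) (b k) \<bullet> frechet_derivative \<phi> (at u) (b l) = (if k = l then 1 else 0)"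
  shows "(\<Sum>j\<in>UNIV. \<Sum>l\<in>UNIV. ricci_coeff (induced_metric \<phi>) j l u * a $ j * a $ l)
    = (\<Sum>k\<in>UNIV. hess (b k) (b k) * hess a a - (hess (b k) a)\<^sup>2)"
proof -
  \<comment> \<open>\<open>w k j\<close> is the second fundamental form on the frame vector
    \<open>b k\<close> and the j-th coordinate vector.\<close>
  define w where "w k j = (\<Sum>m\<in>UNIV. b k $ m * h m j)" for k j
  have aw: "(\<Sum>j\<in>UNIV. w k j * a $ j) = hess (b k) a" for k
    unfolding hess_sum w_def sum_distrib_right by (subst sum.swap) (simp add: mult_ac)
  have ww: "w k j * w k l = (\<Sum>m\<in>UNIV. \<Sum>q\<in>UNIV. b k $ m * h m j * (b k $ q * h q l))" for k j l
    unfolding w_def by (rule sum_product)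
  have aa: "hess (b k) a * hess (b k) a = (\<Sum>j\<in>UNIV. \<Sum>l\<in>UNIV. w k j * a $ j * (w k l * a $ l))" for k
    unfolding aw[symmetric] by (rule sum_product)
  have bb: "(\<Sum>m\<in>UNIV. \<Sum>q\<in>UNIV. b k $ m * b k $ q * h m q) = hess (b k) (b k)" for k
    unfolding hess_sum ..
  have "ricci_coeff (induced_metric \<phi>) j l u =
      (\<Sum>k\<in>UNIV. h l j * hess (b k) (b k) - w k j * w k l)" for j l
  proof -
    have "ricci_coeff (induced_metric \<phi>) j l u =
        (\<Sum>m\<in>UNIV. \<Sum>q\<in>UNIV. \<Sum>k\<in>UNIV. h l j * (b k $ m * b k $ q * h m q) - (b k $ m * h m j) * (b k $ q * h q l))"
      unfolding ricci_coeff_def riemann_eq matrix_inv_orthonormal[OF b]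
      by (simp add: sum_distrib_left sum_distrib_right sum_subtractf h_commute[of l] mult_ac)
    also have "\<dots> = (\<Sum>m\<in>UNIV. \<Sum>k\<in>UNIV. \<Sum>q\<in>UNIV. h l j * (b k $ m * b k $ q * h m q) - (b k $ m * h m j) * (b k $ q * h q l))"
      by (rule sum.cong[OF refl], rule sum.swap)
    also have "\<dots> = (\<Sum>k\<in>UNIV. \<Sum>m\<in>UNIV. \<Sum>q\<in>UNIV. h l j * (b k $ m * b k $ q * h m q) - (b k $ m * h m j) * (b k $ q * h q l))"
      by (rule sum.swap)
    also have "\<dots> = (\<Sum>k\<in>UNIV. h l j * hess (b k) (b k) - w k j * w k l)"
      unfolding bb[symmetric] ww sum_distrib_left sum_subtractf ..
    finally show ?thesis .
  qed
  then have "(\<Sum>j\<in>UNIV. \<Sum>l\<in>UNIV. ricci_coeff (induced_metric \<phi>) j l u * a $ j * a $ l)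
    = (\<Sum>j\<in>UNIV. \<Sum>l\<in>UNIV. \<Sum>k\<in>UNIV. hess (b k) (b k) * (a $ j * a $ l * h j l) - (w k j * a $ j) * (w k l * a $ l))"
    by (simp add: sum_distrib_left right_diff_distrib h_commute mult_ac)
  also have "\<dots> = (\<Sum>j\<in>UNIV. \<Sum>k\<in>UNIV. \<Sum>l\<in>UNIV. hess (b k) (b k) * (a $ j * a $ l * h j l) - (w k j * a $ j) * (w k l * a $ l))"
    by (rule sum.cong[OF refl], rule sum.swap)
  also have "\<dots> = (\<Sum>k\<in>UNIV. \<Sum>j\<in>UNIV. \<Sum>l\<in>UNIV. hess (b k) (b k) * (a $ j * a $ l * h j l) - (w k j * a $ j) * (w k l * a $ l))"
    by (rule sum.swap)
  also have "\<dots> = (\<Sum>k\<in>UNIV. hess (b k) (b k) * hess a a - (hess (b k) a)\<^sup>2)"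
    unfolding aa hess_sum[of a a] power2_eq_square sum_distrib_left sum_subtractf ..
  finally show ?thesis .
qed

end


section \<open>Local parametrizations and unit normals\<close>

lemma local_param_mono: "local_param k S U \<phi> \<Longrightarrow> m \<le> k \<Longrightarrow> local_param m S U \<phi>"
  unfolding local_param_def using Ck_on_mono by blast

lemma local_param_open: "local_param k S U \<phi> \<Longrightarrow> open U"
  by (simp add: local_param_def)

lemma local_param_image: "local_param k S U \<phi> \<Longrightarrow> x \<in> U \<Longrightarrow> \<phi> x \<in> S"
  unfolding local_param_def using openin_imp_subset by blast

lemma local_param_differentiable: "local_param k S U \<phi> \<Longrightarrow> 0 < k \<Longrightarrow> x \<in> U \<Longrightarrow> \<phi> differentiable (at x)"
  unfolding local_param_def using Ck_on_differentiable by blast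

lemma local_param_immersion: "local_param 2 S U \<phi> \<Longrightarrow> immersion \<phi> U"
  by unfold_locales (simp_all add: local_param_def)

lemma at_within_openin:
  assumes "openin (top_of_set S) A" "x \<in> A"
  shows "at x within A = at x within S"
proof -
  obtain T where T: "open T" "A = S \<inter> T"
    using assms(1) by (metis openin_open)
  then show ?thesis using assms(2) by (intro at_within_nhd[of x T]) auto
qed

text \<open>On the image of \<open>U\<close> the composition \<phi> \<circ> \<psi> is the identity,
  so \<open>has_derivative_left_inverse\<close> applies with F = id. Relative openness of the image
  turns a derivative within it into one within \<open>S\<close>.\<close>

lemma local_param_inverse:
  fixes \<phi> :: "'a::euclidean_space \<Rightarrow> 'b::euclidean_space"
  assumes p: "local_param k S U \<phi>" "0 < k"
  obtains \<psi> where "\<And>x. x \<in> U \<Longrightarrow> \<psi> (\<phi> x) = x"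
    "\<And>x. x \<in> U \<Longrightarrow> \<exists>L. linear L \<and> (\<forall>v. L (frechet_derivative \<phi> (at x) v) = v) \<and>
       (\<psi> has_derivative L) (at (\<phi> x) within S)"
proof -
  obtain \<psi> where "homeomorphism U (\<phi> ` U) \<phi> \<psi>"
    using p(1) by (auto simp: local_param_def)
  then have \<psi>: "\<And>x. x \<in> U \<Longrightarrow> \<psi> (\<phi> x) = x" "continuous_on (\<phi> ` U) \<psi>"
    by (auto simp: homeomorphism_def)
  have "\<exists>L. linear L \<and> (\<forall>v. L (frechet_derivative \<phi> (at x) v) = v) \<and>
       (\<psi> has_derivative L) (at (\<phi> x) within S)" if x: "x \<in> U" for x
  proof -
    have d: "\<phi> differentiable (at x)"
      by (rule local_param_differentiable[OF p x])
    have "inj (frechet_derivative \<phi> (at x))"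
      using p(1) x by (simp add: local_param_def)
    then obtain L where L: "linear L" "L \<circ> frechet_derivative \<phi> (at x) = id"
      using linear_injective_left_inverse[OF linear_frechet_derivative[OF d]] by blast
    then have L': "L (frechet_derivative \<phi> (at x) v) = v" for v
      by (metis comp_apply id_apply)
    have "(\<psi> has_derivative (\<lambda>v. L (id v))) (at (\<phi> x) within \<phi> ` U)"
    proof (rule has_derivative_left_inverse[where F = id and F' = id and L = L])
      show "(\<phi> has_derivative frechet_derivative \<phi> (at x)) (at (\<psi> (\<phi> x)))"
        using differentiable_frechet[OF d] by (simp add: \<psi>(1)[OF x])
      show "bounded_linear L" using L(1) by (simp add: linear_conv_bounded_linear)
      show "continuous (at (\<phi> x) within \<phi> ` U) \<psi>"
        using \<psi>(2) x by (simp add: continuous_on_eq_continuous_within)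
      show "(id has_derivative id) (at (\<phi> x) within \<phi> ` U)"
        by (simp add: id_def)
      show "\<forall>\<^sub>F y in at (\<phi> x) within \<phi> ` U. \<phi> (\<psi> y) = id y"
        unfolding eventually_at_filter by (rule always_eventually) (auto simp: \<psi>(1))
    qed (simp_all add: L' \<psi>(1)[OF x])
    moreover have "at (\<phi> x) within \<phi> ` U = at (\<phi> x) within S"
      by (rule at_within_openin) (use p(1) x in \<open>auto simp: local_param_def\<close>)
    ultimately show ?thesis using L(1) L' by auto
  qed
  then show thesis using that[OF \<psi>(1)] by blast
qed

text \<open>\<open>frechet_derivative\<close> within \<open>S\<close> is one choice among several
  possible derivatives. Factoring \<open>f\<close> through the inverse chart shows that one exists;
  composing the chosen one with \<open>\<phi>\<close> and using uniqueness on the open set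
  \<open>U\<close> fixes its values on tangent vectors.\<close>

lemma local_param_dif:
  fixes \<phi> :: "'a::euclidean_space \<Rightarrow> 'b::euclidean_space"
  assumes p: "local_param k S U \<phi>" "0 < k" and x: "x \<in> U"
    and f: "((\<lambda>x. f (\<phi> x)) has_derivative f') (at x)"
  shows "dif S f (\<phi> x) (frechet_derivative \<phi> (at x) v) = f' v"
proof -
  obtain \<psi> L where \<psi>: "\<And>x. x \<in> U \<Longrightarrow> \<psi> (\<phi> x) = x" and L: "(\<psi> has_derivative L) (at (\<phi> x) within S)"
    using local_param_inverse[OF p] x by metis
  have at_eq: "at (\<phi> x) within \<phi> ` U = at (\<phi> x) within S"
    by (rule at_within_openin) (use p(1) x in \<open>auto simp: local_param_def\<close>)
  have "((\<lambda>y. f (\<phi> (\<psi> y))) has_derivative (\<lambda>v. f' (L v))) (at (\<phi> x) within \<phi> ` U)"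
    by (rule has_derivative_compose[where g = "\<lambda>x. f (\<phi> x)"]) (use L f \<psi>[OF x] at_eq in auto)
  then have "(f has_derivative (\<lambda>v. f' (L v))) (at (\<phi> x) within \<phi> ` U)"
    by (rule has_derivative_transform[rotated 2]) (use x \<psi> in auto)
  then have "(f has_derivative frechet_derivative f (at (\<phi> x) within S)) (at (\<phi> x) within \<phi> ` U)"
    unfolding at_eq by (metis differentiableI frechet_derivative_works)
  moreover have "(\<phi> has_derivative frechet_derivative \<phi> (at x)) (at x within U)"
    by (rule has_derivative_at_withinI[OF differentiable_frechet[OF local_param_differentiable[OF p x]]])
  ultimately have "((\<lambda>x. f (\<phi> x)) has_derivative
      (\<lambda>v. frechet_derivative f (at (\<phi> x) within S) (frechet_derivative \<phi> (at x) v))) (at x within U)"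
    using has_derivative_in_compose[of \<phi> _ x U f] by blast
  then have "((\<lambda>x. f (\<phi> x)) has_derivative
      (\<lambda>v. frechet_derivative f (at (\<phi> x) within S) (frechet_derivative \<phi> (at x) v))) (at x)"
    using at_within_open[OF x local_param_open[OF p(1)]] by simp
  from has_derivative_unique[OF this f] show ?thesis
    unfolding dif_def by meson
qed

text \<open>Near 0 a curve in \<open>S\<close> through the point runs in the chart and equals \<phi>
  \<circ> \<psi> \<circ> \<gamma>, which puts its velocity in the range. Conversely, images of
  straight lines realise every vector of the range.\<close>

lemma tangent_space_param:
  fixes \<phi> :: "'a::euclidean_space \<Rightarrow> 'b::euclidean_space"
  assumes p: "local_param k S U \<phi>" "0 < k" and x: "x \<in> U"
  shows "tangent_space S (\<phi> x) = range (frechet_derivative \<phi> (at x))"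
proof (intro equalityI subsetI)
  note d = differentiable_frechet[OF local_param_differentiable[OF p x]]
  obtain \<psi> L where \<psi>: "\<And>x. x \<in> U \<Longrightarrow> \<psi> (\<phi> x) = x" and L: "(\<psi> has_derivative L) (at (\<phi> x) within S)"
    using local_param_inverse[OF p] x by metis
  obtain T where T: "open T" "\<phi> ` U = S \<inter> T"
    using p(1) by (auto simp: local_param_def openin_open)
  fix v assume "v \<in> tangent_space S (\<phi> x)"
  then obtain \<gamma> :: "real \<Rightarrow> 'b" where \<gamma>: "\<gamma> 0 = \<phi> x" "\<forall>\<^sub>F t in at 0. \<gamma> t \<in> S"
    "(\<gamma> has_vector_derivative v) (at 0)"
    unfolding tangent_space_def by blast
  have "continuous (at 0) \<gamma>"
    using \<gamma>(3) has_vector_derivative_continuous by blast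
  moreover have "\<gamma> 0 \<in> T" using T(2) x \<gamma>(1) by auto
  ultimately have "\<forall>\<^sub>F t in at 0. \<gamma> t \<in> T"
    using T(1) topological_tendstoD[of \<gamma> "\<gamma> 0" "at 0" T] unfolding continuous_at by blast
  with \<gamma>(2) have "\<forall>\<^sub>F t in at 0. \<gamma> t \<in> \<phi> ` U"
    unfolding T(2) by eventually_elim simp
  then obtain e where e: "e > 0" "\<And>t. t \<noteq> 0 \<Longrightarrow> dist t 0 < e \<Longrightarrow> \<gamma> t \<in> \<phi> ` U"
    unfolding eventually_at by auto
  have im: "\<gamma> t \<in> \<phi> ` U" if "t \<in> ball 0 e" for t
    using e(2)[of t] that \<gamma>(1) x by (cases "t = 0") (auto simp: dist_commute)
  have "(\<gamma> has_derivative (\<lambda>t. t *\<^sub>R v)) (at 0 within ball 0 e)"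
    using \<gamma>(3) has_derivative_at_withinI unfolding has_vector_derivative_def by blast
  moreover have "(\<psi> has_derivative L) (at (\<gamma> 0) within \<gamma> ` ball 0 e)"
    unfolding \<gamma>(1) by (rule has_derivative_subset[OF L]) (use im T(2) in auto)
  ultimately have "((\<lambda>t. \<psi> (\<gamma> t)) has_derivative (\<lambda>t. L (t *\<^sub>R v))) (at 0 within ball 0 e)"
    by (rule has_derivative_in_compose)
  then have "((\<lambda>t. \<phi> (\<psi> (\<gamma> t))) has_derivative (\<lambda>t. frechet_derivative \<phi> (at x) (L (t *\<^sub>R v)))) (at 0 within ball 0 e)"
    by (rule has_derivative_compose) (use d \<gamma>(1) \<psi>[OF x] in simp)
  then have "(\<gamma> has_derivative (\<lambda>t. frechet_derivative \<phi> (at x) (L (t *\<^sub>R v)))) (at 0 within ball 0 e)"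
    by (rule has_derivative_transform[rotated 2]) (use im \<psi> e(1) in force)+
  then have "(\<gamma> has_derivative (\<lambda>t. frechet_derivative \<phi> (at x) (L (t *\<^sub>R v)))) (at 0)"
    using e(1) by (simp add: at_within_open[of 0 "ball 0 e"])
  from has_derivative_unique[OF this \<gamma>(3)[unfolded has_vector_derivative_def]]
  have "frechet_derivative \<phi> (at x) (L (1 *\<^sub>R v)) = 1 *\<^sub>R v" by meson
  then show "v \<in> range (frechet_derivative \<phi> (at x))" by (metis rangeI scaleR_one)
next
  note d = differentiable_frechet[OF local_param_differentiable[OF p x]]
  fix v assume "v \<in> range (frechet_derivative \<phi> (at x))"
  then obtain \<xi> where \<xi>: "v = frechet_derivative \<phi> (at x) \<xi>" by blast
  have lim: "((\<lambda>t::real. x + t *\<^sub>R \<xi>) has_derivative (\<lambda>t. t *\<^sub>R \<xi>)) (at 0)"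
    by (auto intro!: derivative_eq_intros)
  have "((\<lambda>t::real. \<phi> (x + t *\<^sub>R \<xi>)) has_derivative (\<lambda>t. frechet_derivative \<phi> (at x) (t *\<^sub>R \<xi>))) (at 0)"
    by (rule has_derivative_compose[OF lim]) (use d in simp)
  then have "((\<lambda>t::real. \<phi> (x + t *\<^sub>R \<xi>)) has_vector_derivative v) (at 0)"
    unfolding has_vector_derivative_def \<xi> by (simp add: linear_scale[OF has_derivative_linear[OF d]])
  moreover have "((\<lambda>t::real. x + t *\<^sub>R \<xi>) \<longlongrightarrow> x + 0 *\<^sub>R \<xi>) (at 0)"
    by (intro tendsto_intros)
  then have "\<forall>\<^sub>F t::real in at 0. x + t *\<^sub>R \<xi> \<in> U"
    using x local_param_open[OF p(1)] by (auto dest: topological_tendstoD)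
  then have "\<forall>\<^sub>F t::real in at 0. \<phi> (x + t *\<^sub>R \<xi>) \<in> S"
    by eventually_elim (rule local_param_image[OF p(1)])
  ultimately show "v \<in> tangent_space S (\<phi> x)"
    unfolding tangent_space_def by (auto intro!: exI[of _ "\<lambda>t. \<phi> (x + t *\<^sub>R \<xi>)"])
qed

text \<open>
  The component of \<open>E\<close> along \<open>N = E w\<close> comes for free: with the tangential part \<open>F = E - (E \<bullet> N) N\<close>,
  \<open>1 - E \<bullet> N = \<bar>F\<bar>\<^sup>2 / (1 + E \<bullet> N)\<close>.
\<close>

lemma unit_normal_differentiable:
  fixes E :: "'a::euclidean_space \<Rightarrow> 'n::finite ambient" and D :: "real ^ 'n \<Rightarrow> 'n ambient"
  assumes W: "open W" "w \<in> W" and D: "linear D" "inj D"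
    and A: "\<And>i. A i differentiable (at w)" "\<And>i. A i w = D (axis i 1)"
    and E: "continuous_on W E" "\<And>x. x \<in> W \<Longrightarrow> E x \<bullet> E x = 1" "\<And>i x. x \<in> W \<Longrightarrow> E x \<bullet> A i x = 0"
  shows "E differentiable (at w)"
proof -
  let ?N = "E w"
  have N: "?N \<noteq> 0" using E(2)[OF W(2)] by auto
  have DN: "D c \<bullet> ?N = 0" for c
    unfolding linear_sum_axis[OF D(1), of c] A(2)[symmetric]
    by (simp add: inner_sum_right E(3)[OF W(2)] inner_commute[of _ ?N])
  have Ec: "continuous (at w) E"
    using E(1) W continuous_on_eq_continuous_at by blast
  \<comment> \<open>Orthogonality gives E x \<bullet> A i w = - E x \<bullet> (A i x - A i w), where
    continuity of \<open>E\<close> suffices because the second factor vanishes at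
    \<open>w\<close>.\<close>
  have 1: "(\<lambda>x. E x \<bullet> D (axis i 1)) differentiable (at w)" for i
  proof -
    have "((\<lambda>x. A i x - A i w) has_derivative frechet_derivative (A i) (at w)) (at w)"
      using has_derivative_diff[OF differentiable_frechet[OF A(1)] has_derivative_const] by simp
    from has_derivative_minus[OF has_derivative_inner_vanishing[OF Ec this]]
    have "((\<lambda>x. - (E x \<bullet> (A i x - A i w))) has_derivative (\<lambda>v. - (?N \<bullet> frechet_derivative (A i) (at w) v))) (at w)"
      by simp
    then have "((\<lambda>x. E x \<bullet> D (axis i 1)) has_derivative (\<lambda>v. - (?N \<bullet> frechet_derivative (A i) (at w) v))) (at w)"
      by (rule has_derivative_transform_within_open[OF _ W]) (simp add: inner_diff_right E(3) A(2))
    then show ?thesis by (rule differentiableI)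
  qed
  define F where "F x = E x - (E x \<bullet> ?N) *\<^sub>R ?N" for x
  have Fw: "F w = 0" by (simp add: F_def E(2)[OF W(2)])
  have "F differentiable (at w)"
  proof (rule differentiable_hyperplane[OF D N DN])
    have "(\<lambda>x. F x \<bullet> D (axis i 1)) = (\<lambda>x. E x \<bullet> D (axis i 1))" for i
      by (simp add: F_def inner_diff_left DN[unfolded inner_commute[of _ ?N]])
    then show "(\<lambda>x. F x \<bullet> D (axis i 1)) differentiable (at w)" for i
      using 1 by simp
    show "(\<lambda>x. F x \<bullet> ?N) differentiable (at w)"
      by (simp add: F_def inner_diff_left E(2)[OF W(2)])
  qed
  then obtain F' where F': "(F has_derivative F') (at w)" by (auto simp: differentiable_def)
  have Fc: "continuous (at w) F" by (rule has_derivative_continuous[OF F'])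
  define e where "e x = E x \<bullet> ?N" for x
  have ec: "continuous (at w) e"
    unfolding e_def by (intro continuous_intros Ec)
  have ew: "e w = 1" by (simp add: e_def E(2)[OF W(2)])
  have "continuous (at w) (\<lambda>x. (1 / (1 + e x)) *\<^sub>R F x)"
    by (intro continuous_intros ec Fc) (simp add: ew)
  \<comment> \<open>The continuous factor vanishes at \<open>w\<close> as well, so the derivative of
    the product is 0.\<close>
  from has_derivative_diff[OF has_derivative_const has_derivative_inner_vanishing[OF this F' Fw]]
  have d1: "((\<lambda>x. 1 - ((1 / (1 + e x)) *\<^sub>R F x) \<bullet> F x) has_derivative (\<lambda>v. 0)) (at w)"
    by (simp add: Fw)
  have "(e \<longlongrightarrow> e w) (nhds w)"
    using ec by (simp add: continuous_at tendsto_at_iff_tendsto_nhds)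
  then have "\<forall>\<^sub>F x in nhds w. e x > 0"
    by (rule order_tendstoD) (simp add: ew)
  then obtain V where V: "open V" "w \<in> V" "\<And>x. x \<in> V \<Longrightarrow> e x > 0"
    unfolding eventually_nhds by blast
  note d1 moreover have "open (V \<inter> W)" "w \<in> V \<inter> W" using V W by auto
  ultimately have "(e has_derivative (\<lambda>v. 0)) (at w)"
  proof (rule has_derivative_transform_within_open)
    fix x assume x: "x \<in> V \<inter> W"
    have "F x \<bullet> F x = 1 - e x * e x"
      using x E(2)[of x] E(2)[OF W(2)] unfolding F_def e_def
      by (simp add: inner_diff_left inner_diff_right inner_commute[of ?N "E x"])
    also have "\<dots> = (1 - e x) * (1 + e x)" by (simp add: algebra_simps)
    finally show "1 - (1 / (1 + e x)) *\<^sub>R F x \<bullet> F x = e x"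
      using V(3)[of x] x by simp
  qed
  then have "((\<lambda>x. F x + e x *\<^sub>R ?N) has_derivative (\<lambda>v. F' v + 0 *\<^sub>R ?N)) (at w)"
    by (intro has_derivative_add F' has_derivative_scaleR_left)
  then show ?thesis
    by (auto simp: F_def e_def differentiable_def)
qed


section \<open>Focal sheets\<close>

lemma inner_linear_sum_axis:
  fixes A B :: "real ^ 'n::finite \<Rightarrow> 'b::real_inner"
  assumes "linear A" "linear B"
  shows "A a \<bullet> B b = (\<Sum>k\<in>UNIV. \<Sum>l\<in>UNIV. a $ k * b $ l * (A (axis k 1) \<bullet> B (axis l 1)))"
  unfolding linear_sum_axis[OF assms(1), of a] linear_sum_axis[OF assms(2), of b]
  by (simp add: inner_sum_left inner_sum_right sum_distrib_left mult_ac) (rule sum.swap)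

lemma inner_const_derivative:
  assumes f: "(f has_derivative f') (at x)" and g: "(g has_derivative g') (at x)"
    and W: "open W" "x \<in> W" "\<And>y. y \<in> W \<Longrightarrow> f y \<bullet> g y = c"
  shows "f x \<bullet> g' v + f' v \<bullet> g x = 0"
proof -
  have "((\<lambda>y. c) has_derivative (\<lambda>v. f x \<bullet> g' v + f' v \<bullet> g x)) (at x)"
    by (rule has_derivative_transform_within_open[OF has_derivative_inner[OF f g] W])
  from has_derivative_unique[OF this has_derivative_const] show ?thesis by meson
qed

section \<open>The principal frame in a chart of \<Sigma>\<close>

locale focal =
  fixes \<Sigma> :: "('n::finite) ambient set"
    and \<nu> :: "'n ambient \<Rightarrow> 'n ambient"
    and r :: "'n \<Rightarrow> 'n ambient \<Rightarrow> real"
    and X :: "'n \<Rightarrow> 'n ambient \<Rightarrow> 'n ambient"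
  assumes normal: "unit_normal_field \<Sigma> \<nu>"
    and distinct: "\<And>i j q. q \<in> \<Sigma> \<Longrightarrow> i \<noteq> j \<Longrightarrow> r i q \<noteq> r j q"
    and sheet: "\<And>j. hypersurface 2 (focal_sheet \<Sigma> \<nu> r j)"
    and C1_focal_map: "\<And>j. Ck_map 1 \<Sigma> (focal_map \<nu> r j)"
    and tangent: "\<And>j. tangent_field \<Sigma> (X j)"
    and principal: "\<And>j q. q \<in> \<Sigma> \<Longrightarrow> r j q *\<^sub>R dif \<Sigma> \<nu> q (X j q) = X j q"
    and dif_radius: "\<And>j q. q \<in> \<Sigma> \<Longrightarrow> dif \<Sigma> (r j) q (X j q) = 1"

locale focal_chart = focal \<Sigma> \<nu> r X
  for \<Sigma> :: "('n::finite) ambient set" and \<nu> r X +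
  fixes W :: "(real ^ 'n) set" and \<sigma> :: "real ^ 'n \<Rightarrow> 'n ambient"
  assumes chart: "local_param 3 \<Sigma> W \<sigma>"
begin

sublocale immersion \<sigma> W
  by (rule local_param_immersion[OF local_param_mono[OF chart]]) simp

definition "n x = \<nu> (\<sigma> x)"
definition "\<rho> j x = r j (\<sigma> x)"
definition "Y j x = focal_map \<nu> r j (\<sigma> x)"
definition "Z j x = X j (\<sigma> x)"
definition "E j x = (1 / norm (Z j x)) *\<^sub>R Z j x"

abbreviation "d\<sigma> x \<equiv> frechet_derivative \<sigma> (at x)"
abbreviation "dn x \<equiv> frechet_derivative n (at x)"
abbreviation "d\<rho> j x \<equiv> frechet_derivative (\<rho> j) (at x)"
abbreviation "dE j x \<equiv> frechet_derivative (E j) (at x)"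

text \<open>The coordinates of the principal field in the chart: a preimage under
  \<open>d\<sigma> x\<close> exists by tangency and is unique by injectivity.\<close>

definition "\<xi> j x = inv (d\<sigma> x) (Z j x)"
definition "dY j x v = d\<sigma> x v - (\<rho> j x *\<^sub>R dn x v + d\<rho> j x v *\<^sub>R n x)"

lemma \<sigma>_in: "x \<in> W \<Longrightarrow> \<sigma> x \<in> \<Sigma>"
  by (rule local_param_image[OF chart])

lemma continuous_on_\<sigma>: "continuous_on W \<sigma>"
  by (rule Ck_on_continuous[OF C2])

lemma tangent_space: "x \<in> W \<Longrightarrow> tangent_space \<Sigma> (\<sigma> x) = range (d\<sigma> x)"
  by (rule tangent_space_param[OF chart]) simp_all

lemma dif_chart: "x \<in> W \<Longrightarrow> ((\<lambda>x. f (\<sigma> x)) has_derivative f') (at x) \<Longrightarrow> dif \<Sigma> f (\<sigma> x) (d\<sigma> x v) = f' v"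
  by (rule local_param_dif[OF chart]) simp_all

lemma n_unit: "x \<in> W \<Longrightarrow> n x \<bullet> n x = 1"
  using normal \<sigma>_in unfolding unit_normal_field_def n_def by (metis norm_eq_1)

lemma n_normal: "x \<in> W \<Longrightarrow> n x \<bullet> d\<sigma> x v = 0"
  using normal \<sigma>_in tangent_space unfolding unit_normal_field_def n_def by blast

lemma continuous_on_n: "continuous_on W n"
  unfolding n_def[abs_def]
  by (rule continuous_on_compose2[of \<Sigma> \<nu>])
    (use normal \<sigma>_in continuous_on_\<sigma> in \<open>auto simp: unit_normal_field_def\<close>)

text \<open>Orthogonality to the differentiable frame \<open>pd i \<sigma>\<close> upgrades the
  continuity of the unit normal.\<close>

lemma n_differentiable: "x \<in> W \<Longrightarrow> n differentiable (at x)"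
  by (rule unit_normal_differentiable[OF open_U _ linear_deriv inj, where A = "\<lambda>i. pd i \<sigma>"])
    (simp_all add: pd_differentiable deriv_axis continuous_on_n n_unit n_normal flip: deriv_axis)

lemmas \<sigma>_der = differentiable_frechet[OF differentiable]
lemmas n_der = differentiable_frechet[OF n_differentiable]

lemma dn_n: "x \<in> W \<Longrightarrow> dn x v \<bullet> n x = 0"
  using inner_const_derivative[OF n_der n_der open_U _ n_unit, of x v] by (simp add: inner_commute)

text \<open>Self-adjointness of the shape operator: differentiating the orthogonality of
  \<open>n\<close> and \<open>pd l \<sigma>\<close> expresses the form through second derivatives of
  \<open>\<sigma>\<close>, which commute.\<close>

lemma dn_symmetric:
  assumes x: "x \<in> W"
  shows "dn x a \<bullet> d\<sigma> x b = dn x b \<bullet> d\<sigma> x a"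
proof -
  have 1: "pd k n x \<bullet> pd l \<sigma> x = - (n x \<bullet> pd k (pd l \<sigma>) x)" for k l
  proof -
    have "n y \<bullet> pd l \<sigma> y = 0" if "y \<in> W" for y
      using n_normal[OF that] by (simp add: pd_def)
    from inner_const_derivative[OF n_der[OF x] differentiable_frechet[OF pd_differentiable[OF x]] open_U x this]
    show ?thesis by (simp add: pd_def[of k] add_eq_0_iff)
  qed
  have lin: "linear (dn x)" "linear (d\<sigma> x)"
    using n_der[OF x] \<sigma>_der[OF x] has_derivative_linear by blast+
  show ?thesis
    unfolding inner_linear_sum_axis[OF lin] pd_def[symmetric] 1 pd_commute[OF open_U x C2]
    by (subst sum.swap) (simp add: 1 pd_commute[OF open_U x C2] mult_ac)
qed

lemma Y_C1: "Ck_on 1 W (Y j)"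
  using C1_focal_map[of j] local_param_mono[OF chart, of 1] unfolding Ck_map_def Y_def[abs_def] comp_def by simp

lemma Y_eq: "Y j x = \<sigma> x - \<rho> j x *\<^sub>R n x"
  by (simp add: Y_def focal_map_def \<rho>_def n_def)

text \<open>Passes the regularity of the C^1 focal map on to the radius, whose continuity and
  differentiability are read off from the right-hand side.\<close>

lemma \<rho>_eq: "x \<in> W \<Longrightarrow> \<rho> j x = (\<sigma> x - Y j x) \<bullet> n x"
  by (simp add: Y_eq n_unit)

lemma continuous_on_\<rho>: "continuous_on W (\<rho> j)"
proof (rule continuous_on_eq)
  show "continuous_on W (\<lambda>x. (\<sigma> x - Y j x) \<bullet> n x)"
    by (intro continuous_intros continuous_on_\<sigma> Ck_on_continuous[OF Y_C1] continuous_on_n)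
qed (simp add: \<rho>_eq)

lemma \<rho>_differentiable:
  assumes "x \<in> W"
  shows "\<rho> j differentiable (at x)"
proof -
  have "(\<lambda>x. (\<sigma> x - Y j x) \<bullet> n x) differentiable (at x)"
    using Ck_on_differentiable[OF Y_C1] assms
    by (intro differentiable_inner differentiable_diff differentiable n_differentiable) auto
  then obtain D where "((\<lambda>x. (\<sigma> x - Y j x) \<bullet> n x) has_derivative D) (at x)"
    by (auto simp: differentiable_def)
  then have "(\<rho> j has_derivative D) (at x)"
    by (rule has_derivative_transform_within_open[OF _ open_U assms]) (simp add: \<rho>_eq)
  then show ?thesis by (rule differentiableI)
qed

lemmas \<rho>_der = differentiable_frechet[OF \<rho>_differentiable]

lemma d\<sigma>_\<xi>:
  assumes x: "x \<in> W"
  shows "d\<sigma> x (\<xi> j x) = Z j x"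
proof -
  have "Z j x \<in> range (d\<sigma> x)"
    using tangent \<sigma>_in[OF x] unfolding tangent_space[OF x, symmetric] tangent_field_def Z_def by blast
  then show ?thesis
    unfolding \<xi>_def by (rule f_inv_into_f)
qed

lemma \<rho>_dn_\<xi>: "x \<in> W \<Longrightarrow> \<rho> j x *\<^sub>R dn x (\<xi> j x) = Z j x"
  using principal[OF \<sigma>_in, of x j] dif_chart[OF _ n_der[unfolded n_def[abs_def]], of x "\<xi> j x"]
  by (simp add: d\<sigma>_\<xi> \<rho>_def n_def[abs_def] flip: Z_def)

lemma d\<rho>_\<xi>: "x \<in> W \<Longrightarrow> d\<rho> j x (\<xi> j x) = 1"
  using dif_radius[OF \<sigma>_in, of x j] dif_chart[OF _ \<rho>_der[unfolded \<rho>_def[abs_def]], of x j "\<xi> j x"]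
  by (simp add: d\<sigma>_\<xi> \<rho>_def[abs_def] flip: Z_def)

lemma d\<sigma>_eq_0: "x \<in> W \<Longrightarrow> d\<sigma> x v = 0 \<Longrightarrow> v = 0"
  using inj linear_deriv linear_injective_0 by blast

text \<open>Along a vanishing vector the radius would have derivative 0, against the normalisation
  dr_j(X_j) = 1.\<close>

lemma Z_nonzero:
  assumes x: "x \<in> W"
  shows "Z j x \<noteq> 0"
proof
  assume "Z j x = 0"
  then have "\<xi> j x = 0" using d\<sigma>_\<xi>[OF x] d\<sigma>_eq_0[OF x] by simp
  then show False
    using d\<rho>_\<xi>[OF x, of j] linear_0[OF has_derivative_linear[OF \<rho>_der[OF x]]] by simp
qed

lemma \<rho>_nonzero: "x \<in> W \<Longrightarrow> \<rho> j x \<noteq> 0"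
  using \<rho>_dn_\<xi>[of x j] Z_nonzero[of x j] by auto

lemma \<rho>_distinct: "x \<in> W \<Longrightarrow> i \<noteq> j \<Longrightarrow> \<rho> i x \<noteq> \<rho> j x"
  unfolding \<rho>_def by (rule distinct[OF \<sigma>_in])

lemma dn_\<xi>: "x \<in> W \<Longrightarrow> dn x (\<xi> j x) = (1 / \<rho> j x) *\<^sub>R Z j x"
  using \<rho>_nonzero[of x j] by (simp flip: \<rho>_dn_\<xi>)

lemma Z_E: "x \<in> W \<Longrightarrow> Z j x = norm (Z j x) *\<^sub>R E j x"
  using Z_nonzero[of x j] by (simp add: E_def)

lemma Z_orthogonal:
  assumes x: "x \<in> W" and "i \<noteq> j"
  shows "Z i x \<bullet> Z j x = 0"
proof -
  have "(Z i x \<bullet> Z j x) / \<rho> i x = (Z i x \<bullet> Z j x) / \<rho> j x"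
    using dn_symmetric[OF x, of "\<xi> i x" "\<xi> j x"] by (simp add: dn_\<xi> d\<sigma>_\<xi> x inner_commute)
  then show ?thesis
    using \<rho>_distinct[OF assms] \<rho>_nonzero[OF x] by (simp add: field_simps)
qed

lemma E_orthonormal: "x \<in> W \<Longrightarrow> E i x \<bullet> E j x = (if i = j then 1 else 0)"
  using Z_nonzero[of x j] by (auto simp: E_def Z_orthogonal dot_square_norm power2_eq_square)

lemma Z_inner_E: "x \<in> W \<Longrightarrow> Z i x \<bullet> E j x = (if i = j then norm (Z i x) else 0)"
  by (subst Z_E) (simp_all add: E_orthonormal)

lemma E_unit: "x \<in> W \<Longrightarrow> E i x \<bullet> E i x = 1"
  by (simp add: E_orthonormal)

lemma E_n: "x \<in> W \<Longrightarrow> E j x \<bullet> n x = 0"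
  using n_normal[of x "\<xi> j x"] by (simp add: E_def d\<sigma>_\<xi> inner_commute)

lemma n_E: "x \<in> W \<Longrightarrow> n x \<bullet> E j x = 0"
  using E_n by (simp add: inner_commute)

text \<open>Self-adjointness carries the eigenvalue equation of \<open>E j\<close> over to all
  directions. As an identity of 1-forms in \<open>v\<close> it is what Codazzi's equation
  differentiates.\<close>

lemma dn_E:
  assumes x: "x \<in> W"
  shows "\<rho> j x * (dn x v \<bullet> E j x) = d\<sigma> x v \<bullet> E j x"
proof -
  have "dn x v \<bullet> Z j x = (1 / \<rho> j x) * (d\<sigma> x v \<bullet> Z j x)"
    using dn_symmetric[OF x, of v "\<xi> j x"] by (simp add: dn_\<xi> d\<sigma>_\<xi> x inner_commute)
  then show ?thesis
    using \<rho>_nonzero[OF x] Z_nonzero[OF x] by (simp add: E_def)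
qed

lemma frame_expansion:
  assumes x: "x \<in> W"
  shows "y = (\<Sum>j\<in>UNIV. (y \<bullet> E j x) *\<^sub>R E j x) + (y \<bullet> n x) *\<^sub>R n x"
proof -
  define D where "D c = (\<Sum>j\<in>UNIV. c $ j *\<^sub>R E j x)" for c :: "real ^ 'n"
  have lin: "linear D"
    unfolding D_def by (rule linearI) (simp_all add: algebra_simps sum.distrib scaleR_sum_right)
  have DE: "D c \<bullet> E j x = c $ j" for c j
    by (simp add: D_def inner_sum_left E_orthonormal[OF x] if_distrib cong: if_cong)
  have Dn: "D c \<bullet> n x = 0" for c
    by (simp add: D_def inner_sum_left E_n[OF x])
  have "inj D"
    unfolding linear_injective_0[OF lin] using DE by (metis inner_zero_left vec_eq_iff zero_index)
  moreover have "n x \<noteq> 0" using n_unit[OF x] by auto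
  ultimately obtain c s where y: "y = D c + s *\<^sub>R n x"
    using hyperplane_decomp[OF lin, of "n x" y] Dn by blast
  have "y \<bullet> E j x = c $ j" for j
    by (simp add: y inner_add_left DE n_E[OF x])
  moreover have "y \<bullet> n x = s"
    by (simp add: y inner_add_left Dn n_unit[OF x])
  ultimately show ?thesis by (simp add: y D_def)
qed

lemma continuous_on_E: "continuous_on W (E j)"
proof -
  have "continuous_on W (Z j)"
    unfolding Z_def[abs_def]
    by (rule continuous_on_compose2[of \<Sigma> "X j"])
      (use tangent \<sigma>_in continuous_on_\<sigma> in \<open>auto simp: tangent_field_def\<close>)
  then show ?thesis
    unfolding E_def[abs_def] by (intro continuous_intros) (auto simp: Z_nonzero)
qed

text \<open>In the orthonormal frame \<open>pd k n\<close> has continuous coefficients, the normal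
  one being zero. This admits \<open>n\<close> as the function \<open>F\<close> in
  \<open>ext_deriv_inner\<close>.\<close>

lemma continuous_on_pd_n: "continuous_on W (pd k n)"
proof (rule continuous_on_eq)
  show "continuous_on W (\<lambda>x. \<Sum>j\<in>UNIV. ((pd k \<sigma> x \<bullet> E j x) / \<rho> j x) *\<^sub>R E j x)"
    by (intro continuous_intros continuous_on_pd continuous_on_E continuous_on_\<rho>) (auto simp: \<rho>_nonzero)
  fix x assume x: "x \<in> W"
  have "dn x v \<bullet> E j x = (d\<sigma> x v \<bullet> E j x) / \<rho> j x" for j v
    using dn_E[OF x, of j v] \<rho>_nonzero[OF x, of j] by (simp add: field_simps)
  then show "(\<Sum>j\<in>UNIV. ((pd k \<sigma> x \<bullet> E j x) / \<rho> j x) *\<^sub>R E j x) = pd k n x"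
    using frame_expansion[OF x, of "pd k n x"] by (simp add: pd_def dn_n[OF x])
qed

section \<open>Differential and normal of the focal map\<close>

lemma Y_der: "x \<in> W \<Longrightarrow> (Y j has_derivative dY j x) (at x)"
  unfolding Y_eq[abs_def] dY_def[abs_def]
  by (intro has_derivative_diff has_derivative_scaleR \<sigma>_der \<rho>_der n_der)

text \<open>By \<open>dn_E\<close> the contributions of \<open>d\<sigma>\<close> and of
  \<open>dn\<close> cancel. This makes \<open>E j\<close> a unit normal of the j-th sheet.\<close>

lemma dY_E: "x \<in> W \<Longrightarrow> dY j x v \<bullet> E j x = 0"
  by (simp add: dY_def inner_diff_left inner_add_left dn_E n_E)

text \<open>For k = j the first term vanishes and dr_j(X_j) = 1 leaves -n; the other k supply the
  directions \<open>E k\<close> in the tangent space of the sheet.\<close>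

lemma dY_\<xi>: "x \<in> W \<Longrightarrow> dY j x (\<xi> k x) = (1 - \<rho> j x / \<rho> k x) *\<^sub>R Z k x - d\<rho> j x (\<xi> k x) *\<^sub>R n x"
  by (simp add: dY_def d\<sigma>_\<xi> dn_\<xi> algebra_simps)

text \<open>The component along \<open>n\<close> gives \<open>d\<rho> j x v = 0\<close>. Then, the
  radii being distinct, the components along \<open>E k\<close> with k \<noteq> j make
  \<open>v\<close> a multiple of \<open>\<xi> j x\<close>, and d\<rho>_j(\<xi>_j) = 1 makes the
  multiple zero.\<close>

lemma dY_eq_0:
  assumes x: "x \<in> W" and v: "dY j x v = 0"
  shows "v = 0"
proof -
  have "dY j x v \<bullet> n x = - d\<rho> j x v"
    using n_normal[OF x, of v]
    by (simp add: dY_def inner_diff_left inner_add_left dn_n[OF x] n_unit[OF x] inner_commute[of "d\<sigma> x v"])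
  then have d\<rho>: "d\<rho> j x v = 0" using v by simp
  have E: "d\<sigma> x v \<bullet> E k x = 0" if "k \<noteq> j" for k
  proof -
    have "d\<sigma> x v \<bullet> E k x = \<rho> j x * (dn x v \<bullet> E k x)"
      using v d\<rho> by (simp add: dY_def)
    then have "(\<rho> k x - \<rho> j x) * (dn x v \<bullet> E k x) = 0"
      by (simp add: dn_E[OF x, symmetric] algebra_simps)
    then show ?thesis
      using \<rho>_distinct[OF x that] dn_E[OF x, of k v] by simp
  qed
  define t where "t = (d\<sigma> x v \<bullet> E j x) / norm (Z j x)"
  have "d\<sigma> x v = (\<Sum>k\<in>UNIV. (d\<sigma> x v \<bullet> E k x) *\<^sub>R E k x)"
    using frame_expansion[OF x, of "d\<sigma> x v"] n_normal[OF x, of v] by (simp add: inner_commute)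
  also have "\<dots> = (\<Sum>k\<in>{j}. (d\<sigma> x v \<bullet> E k x) *\<^sub>R E k x)"
    by (rule sum.mono_neutral_right) (auto simp: E)
  also have "\<dots> = t *\<^sub>R d\<sigma> x (\<xi> j x)"
    by (simp add: t_def d\<sigma>_\<xi>[OF x] E_def)
  finally have "d\<sigma> x (v - t *\<^sub>R \<xi> j x) = 0"
    by (simp add: linear_diff[OF linear_deriv[OF x]] linear_scale[OF linear_deriv[OF x]])
  then have vt: "v = t *\<^sub>R \<xi> j x" using d\<sigma>_eq_0[OF x] by force
  have "d\<rho> j x v = t"
    unfolding vt by (simp add: linear_scale[OF has_derivative_linear[OF \<rho>_der[OF x]]] d\<rho>_\<xi>[OF x])
  with d\<rho> vt show ?thesis by simp
qed

text \<open>The focal map is only C^1, so the curvature of the sheet has to be computed in a C^2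
  parametrization \<open>\<phi>\<close>. The map \<open>g\<close> changes from the chart of \<Sigma>
  to that parametrization.\<close>

lemma sheet_transition:
  fixes \<phi> :: "real ^ 'n \<Rightarrow> 'n ambient"
  assumes p: "local_param 2 (focal_sheet \<Sigma> \<nu> r j) U \<phi>" and w: "w \<in> W" and u: "u \<in> U" "\<phi> u = Y j w"
  obtains g V where "open V" "w \<in> V" "V \<subseteq> W" "g w = u"
    "\<And>x. x \<in> V \<Longrightarrow> g x \<in> U"
    "\<And>x. x \<in> V \<Longrightarrow> \<exists>g'. (g has_derivative g') (at x) \<and> (\<forall>v. frechet_derivative \<phi> (at (g x)) (g' v) = dY j x v)"
    "\<And>x b. x \<in> V \<Longrightarrow> E j x \<bullet> frechet_derivative \<phi> (at (g x)) b = 0"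
proof -
  obtain \<psi> where \<psi>: "\<And>x. x \<in> U \<Longrightarrow> \<psi> (\<phi> x) = x"
    "\<And>x. x \<in> U \<Longrightarrow> \<exists>L. linear L \<and> (\<forall>v. L (frechet_derivative \<phi> (at x) v) = v) \<and>
       (\<psi> has_derivative L) (at (\<phi> x) within focal_sheet \<Sigma> \<nu> r j)"
    using local_param_inverse[OF p] by (metis zero_less_numeral)
  obtain T where T: "open T" "\<phi> ` U = focal_sheet \<Sigma> \<nu> r j \<inter> T"
    using p by (auto simp: local_param_def openin_open)
  define V where "V = W \<inter> Y j -` T"
  define g where "g x = \<psi> (Y j x)" for x
  have V: "open V" unfolding V_def
    by (rule continuous_open_preimage[OF Ck_on_continuous[OF Y_C1] open_U T(1)])
  have YS: "Y j x \<in> focal_sheet \<Sigma> \<nu> r j" if "x \<in> W" for x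
    using \<sigma>_in[OF that] by (auto simp: Y_def focal_sheet_def)
  have gV: "g x \<in> U \<and> \<phi> (g x) = Y j x" if "x \<in> V" for x
  proof -
    have "Y j x \<in> \<phi> ` U" using that YS T(2) by (auto simp: V_def)
    then show ?thesis using \<psi>(1) by (auto simp: g_def)
  qed
  have der: "\<exists>g'. (g has_derivative g') (at x) \<and> (\<forall>v. frechet_derivative \<phi> (at (g x)) (g' v) = dY j x v)"
    if x: "x \<in> V" for x
  proof -
    have xW: "x \<in> W" using x by (simp add: V_def)
    obtain L where "(\<psi> has_derivative L) (at (\<phi> (g x)) within focal_sheet \<Sigma> \<nu> r j)"
      using \<psi>(2) gV[OF x] by blast
    then have "(\<psi> has_derivative L) (at (Y j x) within Y j ` V)"
      using gV[OF x] YS by (auto intro: has_derivative_subset simp: V_def)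
    then have "((\<lambda>y. \<psi> (Y j y)) has_derivative (\<lambda>v. L (dY j x v))) (at x within V)"
      by (rule has_derivative_in_compose[OF has_derivative_at_withinI[OF Y_der[OF xW]]])
    then have g: "(g has_derivative (\<lambda>v. L (dY j x v))) (at x)"
      unfolding g_def[abs_def] at_within_open[OF x V] .
    have "\<phi> differentiable (at (g x))"
      using local_param_differentiable[OF p] gV[OF x] by simp
    from has_derivative_compose[OF g differentiable_frechet[OF this]]
    have "(Y j has_derivative (\<lambda>v. frechet_derivative \<phi> (at (g x)) (L (dY j x v)))) (at x)"
      by (rule has_derivative_transform_within_open[OF _ V x]) (simp add: gV)
    from fun_cong[OF has_derivative_unique[OF this Y_der[OF xW]]] g show ?thesis by blast
  qed
  show thesis
  proof
    have "\<phi> u \<in> T" using u(1) T(2) by blast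
    then show "w \<in> V" using w u(2) by (simp add: V_def)
    show "V \<subseteq> W" by (auto simp: V_def)
    show "g w = u" using \<psi>(1)[OF u(1)] by (simp add: g_def u(2))
    fix x b assume x: "x \<in> V"
    then have xW: "x \<in> W" by (simp add: V_def)
    obtain g' where g': "(g has_derivative g') (at x)" "\<And>v. frechet_derivative \<phi> (at (g x)) (g' v) = dY j x v"
      using der[OF x] by blast
    have \<phi>: "linear (frechet_derivative \<phi> (at (g x)))"
      using local_param_differentiable[OF p] gV[OF x] by (simp add: linear_frechet_derivative)
    have lin: "linear g'" by (rule has_derivative_linear[OF g'(1)])
    \<comment> \<open>Injectivity of \<open>dY\<close> makes \<open>g'\<close> bijective, so every
      tangent vector of the sheet is a value of \<open>dY\<close> and hence orthogonal to
      \<open>E j\<close>.\<close>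
    have "inj g'"
      unfolding linear_injective_0[OF lin] using g'(2) dY_eq_0[OF xW] linear_0[OF \<phi>] by metis
    then have "surj g'" using lin by (simp add: linear_injective_imp_surjective)
    then obtain v where "b = g' v" by (metis surjD)
    then show "E j x \<bullet> frechet_derivative \<phi> (at (g x)) b = 0"
      using g'(2) dY_E[OF xW] by (simp add: inner_commute)
  qed (use V gV der in auto)
qed

text \<open>The field \<open>X j\<close> is only continuous on \<Sigma>. The sheet supplies the
  missing regularity: \<open>E j\<close> is a continuous unit normal of a C^2 hypersurface, whose
  tangent frame \<open>pd i \<phi>\<close> stays differentiable when pulled back by
  \<open>g\<close>.\<close>

lemma E_differentiable:
  assumes w: "w \<in> W"
  shows "E j differentiable (at w)"
proof -
  have "Y j w \<in> focal_sheet \<Sigma> \<nu> r j"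
    using \<sigma>_in[OF w] by (auto simp: Y_def focal_sheet_def)
  then obtain U and \<phi> :: "real ^ 'n \<Rightarrow> 'n ambient" and u
    where p: "local_param 2 (focal_sheet \<Sigma> \<nu> r j) U \<phi>" and u: "u \<in> U" "\<phi> u = Y j w"
    using sheet[of j] unfolding hypersurface_def by (metis imageE)
  interpret S: immersion \<phi> U by (rule local_param_immersion[OF p])
  obtain g V where g: "open V" "w \<in> V" "V \<subseteq> W" "g w = u" "\<And>x. x \<in> V \<Longrightarrow> g x \<in> U"
    "\<And>x. x \<in> V \<Longrightarrow> \<exists>g'. (g has_derivative g') (at x) \<and> (\<forall>v. frechet_derivative \<phi> (at (g x)) (g' v) = dY j x v)"
    "\<And>x b. x \<in> V \<Longrightarrow> E j x \<bullet> frechet_derivative \<phi> (at (g x)) b = 0"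
    using sheet_transition[OF p w u] by blast
  have "g differentiable (at w)" using g(6)[OF g(2)] differentiableI by blast
  then have A: "(\<lambda>x. pd i \<phi> (g x)) differentiable (at w)" for i
    using differentiable_chain_at[of g w "pd i \<phi>"] S.pd_differentiable[OF u(1)] g(4) by (simp add: comp_def)
  show ?thesis
    by (rule unit_normal_differentiable[OF g(1,2) S.linear_deriv[OF u(1)] S.inj[OF u(1)] A])
      (use g continuous_on_subset[OF continuous_on_E g(3)] in \<open>auto simp: pd_def E_unit subset_eq\<close>)
qed

lemmas E_der = differentiable_frechet[OF E_differentiable]

text \<open>
  Codazzi's equation as \<open>d\<langle>d\<sigma>, E\<^sub>j\<rangle> = d\<langle>dn, \<rho>\<^sub>j E\<^sub>j\<rangle>\<close>, evaluated on \<open>a\<close>, \<open>b\<close>.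
\<close>

lemma codazzi:
  assumes w: "w \<in> W"
  shows "d\<sigma> w b \<bullet> dE j w a - d\<sigma> w a \<bullet> dE j w b =
    dn w b \<bullet> (\<rho> j w *\<^sub>R dE j w a + d\<rho> j w a *\<^sub>R E j w) - dn w a \<bullet> (\<rho> j w *\<^sub>R dE j w b + d\<rho> j w b *\<^sub>R E j w)"
proof -
  define G' where "G' v = \<rho> j w *\<^sub>R dE j w v + d\<rho> j w v *\<^sub>R E j w" for v
  have G: "((\<lambda>x. \<rho> j x *\<^sub>R E j x) has_derivative G') (at w)"
    unfolding G'_def[abs_def] by (rule has_derivative_scaleR[OF \<rho>_der[OF w] E_der[OF w]])
  let ?\<omega> = "\<lambda>i x. pd i \<sigma> x \<bullet> E j x"
  have axis: "pd l \<sigma> w \<bullet> dE j w (axis k 1) - pd k \<sigma> w \<bullet> dE j w (axis l 1) =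
    pd l n w \<bullet> G' (axis k 1) - pd k n w \<bullet> G' (axis l 1)" for k l
  proof -
    have "ext_deriv ?\<omega> k l w = pd l \<sigma> w \<bullet> dE j w (axis k 1) - pd k \<sigma> w \<bullet> dE j w (axis l 1)"
      by (rule ext_deriv_inner[OF open_U w differentiable continuous_on_pd continuous_on_E E_der[OF w] refl])
    \<comment> \<open>The same form, rewritten by \<open>dn_E\<close>, now has \<open>n\<close> in
      the role of \<open>F\<close>.\<close>
    moreover have "ext_deriv ?\<omega> k l w = pd l n w \<bullet> G' (axis k 1) - pd k n w \<bullet> G' (axis l 1)"
    proof (rule ext_deriv_inner[OF open_U w n_differentiable continuous_on_pd_n _ G])
      show "continuous_on W (\<lambda>x. \<rho> j x *\<^sub>R E j x)"
        by (intro continuous_intros continuous_on_\<rho> continuous_on_E)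
      show "pd i \<sigma> x \<bullet> E j x = pd i n x \<bullet> \<rho> j x *\<^sub>R E j x" if "x \<in> W" for i x
        using dn_E[OF that] by (simp add: pd_def)
    qed
    ultimately show ?thesis by simp
  qed
  have lin: "linear (d\<sigma> w)" "linear (dn w)" "linear (dE j w)" "linear G'"
    using linear_deriv[OF w] has_derivative_linear n_der[OF w] E_der[OF w] G by blast+
  have "d\<sigma> w b \<bullet> dE j w a - d\<sigma> w a \<bullet> dE j w b - (dn w b \<bullet> G' a - dn w a \<bullet> G' b)
      = (\<Sum>k\<in>UNIV. \<Sum>l\<in>UNIV. a $ k * b $ l * ((pd l \<sigma> w \<bullet> dE j w (axis k 1) - pd k \<sigma> w \<bullet> dE j w (axis l 1))
          - (pd l n w \<bullet> G' (axis k 1) - pd k n w \<bullet> G' (axis l 1))))"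
    unfolding inner_commute[of _ "dE j w a"] inner_commute[of _ "G' a"]
      inner_linear_sum_axis[OF lin(3,1), of a b] inner_linear_sum_axis[OF lin(1,3), of a b]
      inner_linear_sum_axis[OF lin(4,2), of a b] inner_linear_sum_axis[OF lin(2,4), of a b]
    by (simp add: pd_def sum_subtractf right_diff_distrib inner_commute)
  also have "\<dots> = 0" by (simp add: axis)
  finally show ?thesis by (simp add: G'_def)
qed

section \<open>Structure equations of the principal frame\<close>

lemma dE_n: "w \<in> W \<Longrightarrow> dE j w v \<bullet> n w = - (E j w \<bullet> dn w v)"
  using inner_const_derivative[OF E_der n_der open_U _ E_n, of w j v] by simp

lemma dE_E: "w \<in> W \<Longrightarrow> dE i w v \<bullet> E j w = - (E i w \<bullet> dE j w v)"
  using inner_const_derivative[OF E_der E_der open_U _ E_orthonormal, of w i j v] by simp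

text \<open>Codazzi's equation on \<xi>_i and \<xi>_j: orthonormality leaves only the component of
  dE_i(\<xi>_j) along E_j and the derivative of \<rho>_j along \<xi>_i. This links the shape of the
  i-th sheet to X_i(r_j).\<close>

lemma codazzi_principal:
  assumes w: "w \<in> W" and "i \<noteq> j"
  shows "(\<rho> i w - \<rho> j w) * norm (Z i w) * (dE i w (\<xi> j w) \<bullet> E j w) / \<rho> i w
      = d\<rho> j w (\<xi> i w) * norm (Z j w) / \<rho> j w"
proof -
  have jj: "Z j w \<bullet> dE j w v = 0" for v
    using dE_E[OF w, of j v j] by (subst Z_E[OF w]) (simp add: inner_commute)
  have ij: "Z i w \<bullet> dE j w v = - (norm (Z i w) * (dE i w v \<bullet> E j w))" for v
    using dE_E[OF w, of i v j] by (subst Z_E[OF w]) simp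
  have "norm (Z i w) * (dE i w (\<xi> j w) \<bullet> E j w) =
    (1 / \<rho> j w) * (d\<rho> j w (\<xi> i w) * norm (Z j w)) + (1 / \<rho> i w) * (\<rho> j w * (norm (Z i w) * (dE i w (\<xi> j w) \<bullet> E j w)))"
    using codazzi[OF w, of "\<xi> j w" j "\<xi> i w"]
    using assms by (simp add: d\<sigma>_\<xi>[OF w] dn_\<xi>[OF w] inner_add_right jj ij Z_inner_E)
  then show ?thesis
    using \<rho>_nonzero[OF w, of i] by (simp add: field_simps)
qed

text \<open>The contracted Gauss equation of the sheet with unit normal \<open>E i w\<close>, in the
  orthonormal frame of -n and the \<open>E k\<close> with k \<noteq> i. As \<open>a\<close>
  represents -n, the k-th summand is the sectional curvature of the plane of \<open>n\<close> and
  \<open>E k\<close>, and Codazzi's equation evaluates it.\<close>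

lemma ricci_coeff_sum:
  fixes \<phi> :: "real ^ 'n \<Rightarrow> 'n ambient"
  assumes p: "local_param 2 (focal_sheet \<Sigma> \<nu> r i) U \<phi>" and w: "w \<in> W" and u: "u \<in> U" "\<phi> u = Y i w"
    and a: "frechet_derivative \<phi> (at u) a = dY i w (\<xi> i w)"
  shows "(\<Sum>j\<in>UNIV. \<Sum>l\<in>UNIV. ricci_coeff (induced_metric \<phi>) j l u * a $ j * a $ l)
    = (\<Sum>k\<in>UNIV - {i}. - d\<rho> k w (\<xi> i w) / (\<rho> i w - \<rho> k w)\<^sup>2)"
proof -
  obtain g V where g: "open V" "w \<in> V" "V \<subseteq> W" "g w = u" "\<And>x. x \<in> V \<Longrightarrow> g x \<in> U"
    "\<And>x. x \<in> V \<Longrightarrow> \<exists>g'. (g has_derivative g') (at x) \<and> (\<forall>v. frechet_derivative \<phi> (at (g x)) (g' v) = dY i x v)"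
    "\<And>x b. x \<in> V \<Longrightarrow> E i x \<bullet> frechet_derivative \<phi> (at (g x)) b = 0"
    using sheet_transition[OF p w u] by blast
  obtain g' where g': "(g has_derivative g') (at w)" "\<And>v. frechet_derivative \<phi> (at u) (g' v) = dY i w v"
    using g(6)[OF g(2)] g(4) by blast
  interpret S0: immersion \<phi> U by (rule local_param_immersion[OF p])
  interpret S: immersion_normal \<phi> U u "E i w"
    by unfold_locales (use u g(7)[OF g(2)] g(4) in \<open>auto simp: E_unit[OF w] pd_def inner_commute\<close>)
  have inj\<phi>: "x = y" if "frechet_derivative \<phi> (at u) x = frechet_derivative \<phi> (at u) y" for x y
    using S0.inj[OF u(1)] that by (meson injD)
  have lin\<phi>: "linear (frechet_derivative \<phi> (at u))" by (rule S0.linear_deriv[OF u(1)])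
  \<comment> \<open>Weingarten's equation: the orthogonality of \<open>E i\<close> and d\<phi> b is
    differentiated along \<open>g\<close>.\<close>
  have hess: "S.hess (g' v) b = - (dE i w v \<bullet> frechet_derivative \<phi> (at u) b)" for v b
  proof -
    have "(\<lambda>x. frechet_derivative \<phi> (at x) b) differentiable (at u)"
      using S0.C2 u(1) by (simp add: numeral_2_eq_2)
    from has_derivative_compose[OF g'(1), of "\<lambda>x. frechet_derivative \<phi> (at x) b"]
      differentiable_frechet[OF this]
    have "((\<lambda>x. frechet_derivative \<phi> (at (g x)) b) has_derivative
        (\<lambda>v. frechet_derivative (\<lambda>x. frechet_derivative \<phi> (at x) b) (at u) (g' v))) (at w)"
      by (simp add: g(4))
    from inner_const_derivative[OF E_der[OF w] this g(1,2,7), of v]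
    show ?thesis
      unfolding S.hess_def by (simp add: inner_commute g(4) add_eq_0_iff2)
  qed
  have a_eq: "a = g' (\<xi> i w)" by (rule inj\<phi>) (simp add: a g'(2))
  have \<phi>a: "frechet_derivative \<phi> (at u) a = - n w"
    by (simp add: a dY_\<xi>[OF w] d\<rho>_\<xi>[OF w] \<rho>_nonzero[OF w])
  \<comment> \<open>The coefficient of \<open>E k w\<close> in
    \<open>dY i w (\<xi> k w)\<close>.\<close>
  define c where "c k = norm (Z k w) * (\<rho> k w - \<rho> i w) / \<rho> k w" for k
  have c: "c k \<noteq> 0" if "k \<noteq> i" for k
    using Z_nonzero[OF w] \<rho>_distinct[OF w that] \<rho>_nonzero[OF w] by (simp add: c_def)
  have dY_k: "dY i w (\<xi> k w) = c k *\<^sub>R E k w - d\<rho> i w (\<xi> k w) *\<^sub>R n w" for k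
    using \<rho>_nonzero[OF w, of k] by (simp add: dY_\<xi>[OF w] c_def E_def Z_nonzero[OF w] field_simps)
  \<comment> \<open>One Gram-Schmidt step: since \<open>a\<close> represents -n, subtracting this
    multiple of it removes the component along \<open>n\<close>.\<close>
  define b where "b k = (if k = i then a else (1 / c k) *\<^sub>R (g' (\<xi> k w) - d\<rho> i w (\<xi> k w) *\<^sub>R a))" for k
  have \<phi>b: "frechet_derivative \<phi> (at u) (b k) = (if k = i then - n w else E k w)" for k
    using c[of k] by (simp add: b_def \<phi>a linear_scale[OF lin\<phi>] linear_diff[OF lin\<phi>] g'(2) dY_k)
  have orth: "frechet_derivative \<phi> (at u) (b k) \<bullet> frechet_derivative \<phi> (at u) (b l) = (if k = l then 1 else 0)" for k l
    unfolding \<phi>b by (simp add: E_n[OF w] n_unit[OF w] E_orthonormal[OF w] n_E[OF w])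
  define H where "H = S.hess a a"
  have H: "H = - (norm (Z i w) / \<rho> i w)"
  proof -
    have "H = dE i w (\<xi> i w) \<bullet> n w"
      unfolding H_def by (subst (1) a_eq) (simp add: hess \<phi>a)
    also have "\<dots> = - (norm (Z i w) / \<rho> i w)"
      by (simp add: dE_n[OF w] dn_\<xi>[OF w] Z_inner_E[OF w] inner_commute[of "E i w" "Z i w"])
    finally show ?thesis .
  qed
  have summand: "S.hess (b k) (b k) * H - (S.hess (b k) a)\<^sup>2 = - d\<rho> k w (\<xi> i w) / (\<rho> i w - \<rho> k w)\<^sup>2"
    if k: "k \<noteq> i" for k
  proof -
    define d where "d = d\<rho> i w (\<xi> k w)"
    define m where "m = dE i w (\<xi> k w) \<bullet> E k w"
    have gk: "g' (\<xi> k w) = c k *\<^sub>R b k + d *\<^sub>R a"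
      using c[OF k] by (simp add: b_def k d_def)
    have lin: "S.hess (g' (\<xi> k w)) y = c k * S.hess (b k) y + d * S.hess a y" for y
      unfolding gk S.hess_sum
      by (simp add: sum_distrib_left sum.distrib algebra_simps)
    \<comment> \<open>The directions \<xi>_k and \<xi>_i are conjugate on the sheet, because dn
      \<xi>_k is a multiple of E_k and so orthogonal to E_i.\<close>
    have "S.hess (g' (\<xi> k w)) a = 0"
      using k by (simp add: hess \<phi>a dE_n[OF w] dn_\<xi>[OF w] Z_inner_E[OF w] inner_commute[of "E i w" "Z k w"])
    then have 1: "c k * S.hess (b k) a = - d * H"
      unfolding lin H_def by simp
    have "S.hess (g' (\<xi> k w)) (b k) = - m"
      using k by (simp add: hess \<phi>b m_def)
    then have 2: "c k * S.hess (b k) (b k) = - m - d * S.hess (b k) a"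
      unfolding lin S.hess_commute[of a] by simp
    \<comment> \<open>The derivative \<open>d\<close> of \<rho>_i along \<xi>_k cancels in this
      combination; only \<open>m\<close> survives.\<close>
    have "c k * (S.hess (b k) (b k) * H - (S.hess (b k) a)\<^sup>2)
        = (c k * S.hess (b k) (b k)) * H - (c k * S.hess (b k) a) * S.hess (b k) a"
      by (simp add: power2_eq_square algebra_simps)
    also have "\<dots> = - m * H"
      unfolding 1 2 by (simp add: algebra_simps)
    finally have "c k * (S.hess (b k) (b k) * H - (S.hess (b k) a)\<^sup>2) = norm (Z i w) * m / \<rho> i w"
      by (simp add: H)
    then have 3: "S.hess (b k) (b k) * H - (S.hess (b k) a)\<^sup>2 = (norm (Z i w) * m / \<rho> i w) / c k"
      using c[OF k] by (metis nonzero_mult_div_cancel_left)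
    \<comment> \<open>Codazzi's equation trades \<open>m\<close> for the derivative of \<rho>_k
      along \<xi>_i.\<close>
    have "(\<rho> i w - \<rho> k w) * (norm (Z i w) * m / \<rho> i w) = d\<rho> k w (\<xi> i w) * norm (Z k w) / \<rho> k w"
      using codazzi_principal[OF w, of i k] k by (simp add: m_def)
    then have 4: "norm (Z i w) * m / \<rho> i w = (d\<rho> k w (\<xi> i w) * norm (Z k w) / \<rho> k w) / (\<rho> i w - \<rho> k w)"
      using \<rho>_distinct[OF w, of i k] k by (metis nonzero_mult_div_cancel_left right_minus_eq)
    have ne: "\<rho> i w - \<rho> k w \<noteq> 0" "\<rho> k w \<noteq> 0" "norm (Z k w) \<noteq> 0"
      using \<rho>_distinct[OF w, of i k] \<rho>_nonzero[OF w] Z_nonzero[OF w] k by auto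
    have c': "c k = - (norm (Z k w) * (\<rho> i w - \<rho> k w) / \<rho> k w)"
      by (simp add: c_def algebra_simps diff_divide_distrib)
    show ?thesis
      unfolding 3 4 c' using ne by (simp add: power2_eq_square)
  qed
  have "(\<Sum>j\<in>UNIV. \<Sum>l\<in>UNIV. ricci_coeff (induced_metric \<phi>) j l u * a $ j * a $ l)
    = (\<Sum>k\<in>UNIV. S.hess (b k) (b k) * H - (S.hess (b k) a)\<^sup>2)"
    unfolding H_def by (rule S.ricci_eq[OF orth])
  \<comment> \<open>The summand for \<open>i\<close> vanishes because \<open>b i\<close> is
    \<open>a\<close>.\<close>
  also have "\<dots> = (\<Sum>k\<in>UNIV - {i}. S.hess (b k) (b k) * H - (S.hess (b k) a)\<^sup>2)"
    by (rule sum.mono_neutral_right) (auto simp: b_def H_def power2_eq_square)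
  also have "\<dots> = (\<Sum>k\<in>UNIV - {i}. - d\<rho> k w (\<xi> i w) / (\<rho> i w - \<rho> k w)\<^sup>2)"
    by (rule sum.cong) (use summand in auto)
  finally show ?thesis .
qed

text \<open>\<open>ricci\<close> is a definite description. By \<open>ricci_coeff_sum\<close> the
  value is the same in every C^2 parametrization, and the existence of one determines it.\<close>

lemma ricci_focal_sheet:
  assumes w: "w \<in> W"
  shows "ricci (focal_sheet \<Sigma> \<nu> r i) (Y i w) (dY i w (\<xi> i w)) (dY i w (\<xi> i w))
    = (\<Sum>k\<in>UNIV - {i}. - d\<rho> k w (\<xi> i w) / (\<rho> i w - \<rho> k w)\<^sup>2)" (is "_ = ?R")
  unfolding ricci_def
proof (rule the_equality, intro allI impI)
  fix U and \<phi> :: "real ^ 'n \<Rightarrow> 'n ambient" and u a b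
  assume as: "local_param 2 (focal_sheet \<Sigma> \<nu> r i) U \<phi> \<and> u \<in> U \<and> \<phi> u = Y i w \<and>
    frechet_derivative \<phi> (at u) a = dY i w (\<xi> i w) \<and> frechet_derivative \<phi> (at u) b = dY i w (\<xi> i w)"
  then have "b = a"
    by (metis local_param_def injD)
  then show "?R = (\<Sum>j\<in>UNIV. \<Sum>l\<in>UNIV. ricci_coeff (induced_metric \<phi>) j l u * a $ j * b $ l)"
    using ricci_coeff_sum[OF _ w, of i U \<phi> u a] as by simp
next
  fix c
  assume *: "\<forall>U (\<phi> :: real ^ 'n \<Rightarrow> 'n ambient) u a b. local_param 2 (focal_sheet \<Sigma> \<nu> r i) U \<phi> \<and> u \<in> U \<and> \<phi> u = Y i w \<and>
    frechet_derivative \<phi> (at u) a = dY i w (\<xi> i w) \<and> frechet_derivative \<phi> (at u) b = dY i w (\<xi> i w) \<longrightarrow>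
    c = (\<Sum>j\<in>UNIV. \<Sum>l\<in>UNIV. ricci_coeff (induced_metric \<phi>) j l u * a $ j * b $ l)"
  have "Y i w \<in> focal_sheet \<Sigma> \<nu> r i"
    using \<sigma>_in[OF w] by (auto simp: Y_def focal_sheet_def)
  then obtain U and \<phi> :: "real ^ 'n \<Rightarrow> 'n ambient" and u
    where p: "local_param 2 (focal_sheet \<Sigma> \<nu> r i) U \<phi>" and u: "u \<in> U" "\<phi> u = Y i w"
    using sheet[of i] unfolding hypersurface_def by (metis imageE)
  \<comment> \<open>The transition map provides the coordinates; without an admissible instance
    every \<open>c\<close> would satisfy the description.\<close>
  obtain a where a: "frechet_derivative \<phi> (at u) a = dY i w (\<xi> i w)"
    using sheet_transition[OF p w u] by metis
  show "c = ?R"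
    using * p u a ricci_coeff_sum[OF p w u a] by blast
qed

end

theorem theorem3:
  fixes \<Sigma> :: "('n::finite) ambient set"
    and \<nu> :: "'n ambient \<Rightarrow> 'n ambient"
    and r :: "'n \<Rightarrow> 'n ambient \<Rightarrow> real"
    and X :: "'n \<Rightarrow> 'n ambient \<Rightarrow> 'n ambient"
  assumes "hypersurface 3 \<Sigma>"
    and "unit_normal_field \<Sigma> \<nu>"
    and "strictly_convex \<Sigma> \<nu>"
    and "simple_radii_of_curvature \<Sigma> \<nu> r"
    and "\<And>j. hypersurface 2 (focal_sheet \<Sigma> \<nu> r j)"
    and "\<And>j. diffeomorphism \<Sigma> (focal_sheet \<Sigma> \<nu> r j) (focal_map \<nu> r j)"
    and "\<And>j. tangent_field \<Sigma> (X j)"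
    and "\<And>j q. q \<in> \<Sigma> \<Longrightarrow> r j q *\<^sub>R dif \<Sigma> \<nu> q (X j q) = X j q"
    and "\<And>j q. q \<in> \<Sigma> \<Longrightarrow> dif \<Sigma> (r j) q (X j q) = 1"
  shows "\<forall>i. \<forall>q\<in>\<Sigma>.
    ricci (focal_sheet \<Sigma> \<nu> r i) (focal_map \<nu> r i q)
        (dif \<Sigma> (focal_map \<nu> r i) q (X i q)) (dif \<Sigma> (focal_map \<nu> r i) q (X i q)) =
      (\<Sum>j\<in>UNIV - {i}. (dif \<Sigma> (astigmatism r i j) q (X i q) - 1) / (astigmatism r i j q)\<^sup>2)"
proof (intro allI ballI)
  fix i q assume q: "q \<in> \<Sigma>"
  obtain W and \<sigma> :: "real ^ 'n \<Rightarrow> 'n ambient" and w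
    where chart: "local_param 3 \<Sigma> W \<sigma>" and w: "w \<in> W" "q = \<sigma> w"
    using assms(1) q unfolding hypersurface_def by (metis imageE)
  interpret focal_chart \<Sigma> \<nu> r X W \<sigma>
    using assms chart
    by unfold_locales (auto simp: simple_radii_of_curvature_def diffeomorphism_def)
  have X: "X i q = d\<sigma> w (\<xi> i w)"
    by (simp add: d\<sigma>_\<xi>[OF w(1)] Z_def w(2))
  have Y: "dif \<Sigma> (focal_map \<nu> r i) q (X i q) = dY i w (\<xi> i w)"
    unfolding X unfolding w(2) by (rule dif_chart[OF w(1)]) (use Y_der[OF w(1)] in \<open>simp add: Y_def[abs_def]\<close>)
  \<comment> \<open>Since dr_i(X_i) = 1, the numerator X_i(s_ij) - 1 becomes -X_i(r_j).\<close>
  have s: "dif \<Sigma> (astigmatism r i j) q (X i q) = 1 - d\<rho> j w (\<xi> i w)" for j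
  proof -
    have "((\<lambda>x. astigmatism r i j (\<sigma> x)) has_derivative (\<lambda>v. d\<rho> i w v - d\<rho> j w v)) (at w)"
      using has_derivative_diff[OF \<rho>_der \<rho>_der, OF w(1) w(1)] by (simp add: astigmatism_def \<rho>_def[abs_def])
    from dif_chart[OF w(1) this] show ?thesis
      unfolding X unfolding w(2) by (simp add: d\<rho>_\<xi>[OF w(1)])
  qed
  show "ricci (focal_sheet \<Sigma> \<nu> r i) (focal_map \<nu> r i q)
        (dif \<Sigma> (focal_map \<nu> r i) q (X i q)) (dif \<Sigma> (focal_map \<nu> r i) q (X i q)) =
      (\<Sum>j\<in>UNIV - {i}. (dif \<Sigma> (astigmatism r i j) q (X i q) - 1) / (astigmatism r i j q)\<^sup>2)"
    unfolding Y s using ricci_focal_sheet[OF w(1), of i]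
    by (simp add: Y_def w(2) astigmatism_def \<rho>_def)
qed

end
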